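(* Let $k,d\in\mathbb{N}^+$ and let $G$ be a graph. There is an algorithm that correctly decides whether $G$ is a positive instance of $(k,d)$-Fracture Deletion in time $O(\max(k+1,2d-1)^d\,|G|)$, and which, within the same time bound, outputs a $k$-fracture deletion set of size $d$ of $G$ if one exists.
   Context: $|G|=|V(G)|+|E(G)|$. For $k,d\in\mathbb{N}$, a $k$-fracture deletion set of size $d$ in $G$ is a set $S\subseteq V(G)$ with $|S|=d$ such that every connected component of $G-S$ has at most $k$ vertices. The problem $(k,d)$-Fracture Deletion asks, given $G$, $k$ and $d$, whether such a set exists. *)

theory Defs
  imports Main
begin

section \<open>Graphs and fracture deletion sets\<close>

type_synonym 'a ugraph = "'a set \<times> 'a set set"

abbreviation verts :: "'a ugraph \<Rightarrow> 'a set" where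
  "verts G \<equiv> fst G"

abbreviation edges :: "'a ugraph \<Rightarrow> 'a set set" where
  "edges G \<equiv> snd G"

definition simple_graph :: "'a ugraph \<Rightarrow> bool" where
  "simple_graph G \<longleftrightarrow> finite (verts G) \<and> (\<forall>e\<in>edges G. e \<subseteq> verts G \<and> card e = 2)"

definition graph_size :: "'a ugraph \<Rightarrow> nat" where
  "graph_size G = card (verts G) + card (edges G)"

definition delete_verts :: "'a ugraph \<Rightarrow> 'a set \<Rightarrow> 'a ugraph" where
  "delete_verts G S = (verts G - S, {e \<in> edges G. e \<inter> S = {}})"

definition adj :: "'a ugraph \<Rightarrow> 'a rel" where
  "adj G = {(u, v). {u, v} \<in> edges G}"

text \<open>The vertex sets of the connected components.\<close>

definition components :: "'a ugraph \<Rightarrow> 'a set set" where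
  "components G = {{w \<in> verts G. (v, w) \<in> (adj G)\<^sup>*} | v. v \<in> verts G}"

definition fracture_deletion_set :: "nat \<Rightarrow> nat \<Rightarrow> 'a ugraph \<Rightarrow> 'a set \<Rightarrow> bool" where
  "fracture_deletion_set k d G S \<longleftrightarrow>
     S \<subseteq> verts G \<and> card S = d \<and> (\<forall>C\<in>components (delete_verts G S). card C \<le> k)"

definition fracture_deletion :: "nat \<Rightarrow> nat \<Rightarrow> 'a ugraph \<Rightarrow> bool" where
  "fracture_deletion k d G \<longleftrightarrow> (\<exists>S. fracture_deletion_set k d G S)"


section \<open>Random access machine\<close>

text \<open>
  Algorithms are programs for a unit-cost random access machine over the natural numbers,
  written with structured control flow. A program refers to finitely many registers and to
  finitely many unbounded arrays, all of them named by numbers. The arithmetic operations are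
  addition and truncated subtraction only: with unit-cost multiplication the machine would be
  unreasonably powerful.
\<close>

datatype aexp =
    Const nat
  | Reg nat
  | Cell nat aexp
  | Plus aexp aexp
  | Minus aexp aexp

datatype bexp =
    Less aexp aexp
  | Equal aexp aexp
  | Neg bexp
  | Conj bexp bexp

datatype com =
    Skip
  | Assign nat aexp
  | Store nat aexp aexp
  | Seq com com
  | Cond bexp com com
  | While bexp com

record state =
  regs :: "nat \<Rightarrow> nat"
  arrs :: "nat \<Rightarrow> nat \<Rightarrow> nat"

primrec aval :: "aexp \<Rightarrow> state \<Rightarrow> nat" where
  "aval (Const n) s = n"
| "aval (Reg r) s = regs s r"
| "aval (Cell a i) s = arrs s a (aval i s)"
| "aval (Plus x y) s = aval x s + aval y s"
| "aval (Minus x y) s = aval x s - aval y s"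

primrec bval :: "bexp \<Rightarrow> state \<Rightarrow> bool" where
  "bval (Less x y) s = (aval x s < aval y s)"
| "bval (Equal x y) s = (aval x s = aval y s)"
| "bval (Neg b) s = (\<not> bval b s)"
| "bval (Conj b c) s = (bval b s \<and> bval c s)"

primrec acost :: "aexp \<Rightarrow> nat" where
  "acost (Const n) = 1"
| "acost (Reg r) = 1"
| "acost (Cell a i) = acost i + 1"
| "acost (Plus x y) = acost x + acost y + 1"
| "acost (Minus x y) = acost x + acost y + 1"

primrec bcost :: "bexp \<Rightarrow> nat" where
  "bcost (Less x y) = acost x + acost y + 1"
| "bcost (Equal x y) = acost x + acost y + 1"
| "bcost (Neg b) = bcost b + 1"
| "bcost (Conj b c) = bcost b + bcost c + 1"

text \<open>
  \<open>exec P s t s'\<close>: started in state \<open>s\<close>, program \<open>P\<close> halts in state \<open>s'\<close>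
  after \<open>t\<close> elementary operations.
\<close>

inductive exec :: "com \<Rightarrow> state \<Rightarrow> nat \<Rightarrow> state \<Rightarrow> bool" where
  exec_Skip: "exec Skip s 1 s"
| exec_Assign: "exec (Assign r x) s (acost x + 1) (s\<lparr>regs := (regs s)(r := aval x s)\<rparr>)"
| exec_Store: "exec (Store a i x) s (acost i + acost x + 1)
    (s\<lparr>arrs := (arrs s)(a := (arrs s a)(aval i s := aval x s))\<rparr>)"
| exec_Seq: "exec P s t s' \<Longrightarrow> exec Q s' u s'' \<Longrightarrow> exec (Seq P Q) s (t + u) s''"
| exec_CondTrue: "bval b s \<Longrightarrow> exec P s t s' \<Longrightarrow> exec (Cond b P Q) s (bcost b + 1 + t) s'"
| exec_CondFalse: "\<not> bval b s \<Longrightarrow> exec Q s t s' \<Longrightarrow> exec (Cond b P Q) s (bcost b + 1 + t) s'"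
| exec_WhileFalse: "\<not> bval b s \<Longrightarrow> exec (While b P) s (bcost b + 1) s"
| exec_WhileTrue: "bval b s \<Longrightarrow> exec P s t s' \<Longrightarrow> exec (While b P) s' u s''
    \<Longrightarrow> exec (While b P) s (bcost b + 1 + t + u) s''"

inductive_cases exec_SkipE: "exec Skip s t s'"
inductive_cases exec_AssignE: "exec (Assign r x) s t s'"
inductive_cases exec_StoreE: "exec (Store a i x) s t s'"
inductive_cases exec_SeqE: "exec (Seq P Q) s t s'"
inductive_cases exec_CondE: "exec (Cond b P Q) s t s'"
inductive_cases exec_WhileE: "exec (While b P) s t s'"

lemma exec_deterministic:
  assumes "exec P s t s'" and "exec P s u s''"
  shows "u = t \<and> s'' = s'"
  using assms
proof (induction arbitrary: u s'' rule: exec.induct)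
  case (exec_Skip s)
  then show ?case by (rule exec_SkipE) simp
next
  case (exec_Assign r x s)
  then show ?case by (rule exec_AssignE) simp
next
  case (exec_Store a i x s)
  then show ?case by (rule exec_StoreE) simp
next
  case (exec_Seq P s t s' Q v s3)
  from exec_Seq.prems obtain x y m
    where 1: "u = x + y" "exec P s x m" "exec Q m y s''"
    by (rule exec_SeqE)
  have "x = t" "m = s'" using exec_Seq.IH(1)[OF 1(2)] by simp_all
  with 1 exec_Seq.IH(2)[of y s''] show ?case by simp
next
  case (exec_CondTrue b s P t s' Q)
  then obtain x where 1: "u = Suc (bcost b + x)" "exec P s x s''"
    by (metis exec_CondE)
  with exec_CondTrue.IH[OF 1(2)] show ?case by simp
next
  case (exec_CondFalse b s Q t s' P)
  then obtain x where 1: "u = Suc (bcost b + x)" "exec Q s x s''"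
    by (metis exec_CondE)
  with exec_CondFalse.IH[OF 1(2)] show ?case by simp
next
  case (exec_WhileFalse b s P)
  from exec_WhileFalse.prems show ?case
    by (rule exec_WhileE) (use exec_WhileFalse.hyps in simp_all)
next
  case (exec_WhileTrue b s P t s' v s3)
  then obtain x y m
    where 1: "u = Suc (bcost b + x + y)" "exec P s x m" "exec (While b P) m y s''"
    by (metis exec_WhileE)
  have "x = t" "m = s'" using exec_WhileTrue.IH(1)[OF 1(2)] by simp_all
  with 1 exec_WhileTrue.IH(2)[of y s''] show ?case by simp
qed


section \<open>Encoding of instances\<close>

text \<open>
  The list \<open>vs\<close> numbers the vertices in an arbitrary order, and \<open>al ! i\<close> lists, in an
  arbitrary order and without repetition, the numbers of the neighbours of vertex number \<open>i\<close>.
\<close>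

definition adjacency_lists :: "'a ugraph \<Rightarrow> 'a list \<Rightarrow> nat list list \<Rightarrow> bool" where
  "adjacency_lists G vs al \<longleftrightarrow>
     distinct vs \<and> set vs = verts G \<and> length al = length vs \<and>
     (\<forall>i<length vs. distinct (al ! i) \<and>
        set (al ! i) = {j. j < length vs \<and> {vs ! i, vs ! j} \<in> edges G})"

text \<open>
  Registers 0, 1, 2 hold the number of vertices, \<open>k\<close> and \<open>d\<close>. Array 1 is the concatenation of
  the adjacency lists; the list of vertex \<open>i\<close> occupies the positions from entry \<open>i\<close> of array 0
  up to, but excluding, entry \<open>i + 1\<close> of array 0. Everything else is 0.
\<close>

definition input_state :: "nat \<Rightarrow> nat \<Rightarrow> nat list list \<Rightarrow> state" where
  "input_state k d al =
     \<lparr>regs = (\<lambda>_. 0)(0 := length al, 1 := k, 2 := d),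
      arrs = (\<lambda>_ _. 0)
        (0 := (\<lambda>i. if i \<le> length al then length (concat (take i al)) else 0),
         1 := (\<lambda>j. if j < length (concat al) then concat al ! j else 0))\<rparr>"

text \<open>The answer is in register 3, the numbers of the chosen vertices are in array 2.\<close>

definition answer :: "state \<Rightarrow> nat" where
  "answer s = regs s 3"

definition output_list :: "nat \<Rightarrow> state \<Rightarrow> nat list" where
  "output_list d s = map (arrs s 2) [0..<d]"

end

theory Submission
  imports Defs
begin

text \<open>
  Bounded search tree. If some component of \<open>G - D\<close> has more than \<open>k\<close> vertices, a breadth-first
  search finds \<open>k + 1\<close> vertices which induce a connected subgraph, and every fracture deletion set
  containing \<open>D\<close> contains one of them; so it suffices to branch over these \<open>k + 1\<close> vertices. The tree
  has depth \<open>d\<close>, hence at most \<open>2 (k + 1)\<^sup>d\<close> nodes as \<open>k \<ge> 1\<close>, and each node costs linear time.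
  A solution with fewer than \<open>d\<close> vertices is padded by arbitrary vertices, as fractured graphs stay
  fractured under deletions. If \<open>d\<close> exceeds the number of vertices, the answer is negative.

  The tree is traversed with a stack of unvisited nodes. A node is a pair of its remaining budget \<open>r\<close>
  and the vertex \<open>v\<close> chosen to reach it; visiting it stores \<open>v\<close> in cell \<open>r\<close> of array 2, so that
  cells \<open>r, \<dots>, d\<close> hold the deleted vertices. Budgets do not increase towards the top of the stack,
  therefore the cells above \<open>r\<close> are still valid when a node of budget \<open>r\<close> is popped. The
  root chooses the dummy vertex number \<open>n\<close>, stored in cell \<open>d\<close>, just outside the output.

  Registers: 3 success flag, 4 stack height, 5 budget \<open>r\<close>, 6 loop counter or next root of the search,
  7 and 8 head and tail of the queue, 9 start of the current component in the queue, 10 position in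
  the adjacency lists, 11 neighbour. Arrays: 2 chosen vertices, 3 marks (1 deleted, 2 reached),
  4 queue, 5 and 6 budgets and vertices of the stack.
\<close>

section \<open>Weakest preconditions with running time\<close>

text \<open>Total correctness: some halting run is asserted to exist, and as \<open>exec\<close> is
  deterministic it is the only one.\<close>

definition wp :: "com \<Rightarrow> (nat \<Rightarrow> state \<Rightarrow> bool) \<Rightarrow> state \<Rightarrow> bool" where
  "wp P Q s \<longleftrightarrow> (\<exists>t s'. exec P s t s' \<and> Q t s')"

lemma wp_mono: "wp P Q s \<Longrightarrow> (\<And>t s'. Q t s' \<Longrightarrow> Q' t s') \<Longrightarrow> wp P Q' s"
  unfolding wp_def by blast

lemma wp_Skip: "Q 1 s \<Longrightarrow> wp Skip Q s"
  unfolding wp_def using exec_Skip by blast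

lemma wp_Assign:
  "Q (acost x + 1) (s\<lparr>regs := (regs s)(r := aval x s)\<rparr>) \<Longrightarrow> wp (Assign r x) Q s"
  unfolding wp_def using exec_Assign by blast

lemma wp_Store:
  "Q (acost i + acost x + 1) (s\<lparr>arrs := (arrs s)(a := (arrs s a)(aval i s := aval x s))\<rparr>)
   \<Longrightarrow> wp (Store a i x) Q s"
  unfolding wp_def using exec_Store by blast

lemma wp_Seq: "wp P (\<lambda>t. wp R (\<lambda>u. Q (t + u))) s \<Longrightarrow> wp (Seq P R) Q s"
  unfolding wp_def using exec_Seq by blast

lemma wp_Cond:
  "(bval b s \<Longrightarrow> wp P (\<lambda>t. Q (bcost b + 1 + t)) s)
   \<Longrightarrow> (\<not> bval b s \<Longrightarrow> wp R (\<lambda>t. Q (bcost b + 1 + t)) s) \<Longrightarrow> wp (Cond b P R) Q s"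
  unfolding wp_def using exec_CondTrue exec_CondFalse by metis

lemma wp_Seq_bound:
  assumes "wp P (\<lambda>t s'. t \<le> T \<and> J s') s" "\<And>s'. J s' \<Longrightarrow> wp R (\<lambda>u s''. u \<le> U \<and> Q s'') s'"
  shows "wp (Seq P R) (\<lambda>t s''. t \<le> T + U \<and> Q s'') s"
  using assms by (intro wp_Seq) (fastforce elim!: wp_mono)

lemmas wp_simple = wp_Seq wp_Assign wp_Store wp_Skip wp_Cond

text \<open>The potential \<open>\<Phi>\<close> pays for every iteration, including the evaluation of the guard.\<close>

lemma wp_While:
  assumes "I s"
    and "\<And>s. I s \<Longrightarrow> bval b s \<Longrightarrow> wp P (\<lambda>t s'. I s' \<and> t + \<Phi> s' + bcost b + 1 \<le> \<Phi> s) s"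
  shows "wp (While b P) (\<lambda>t s'. I s' \<and> \<not> bval b s' \<and> t + \<Phi> s' \<le> \<Phi> s + bcost b + 1) s"
  using assms(1)
\<comment> \<open>The potential drops by at least \<open>bcost b + 1\<close> per round, so induction
  on it yields termination as well. The surplus \<open>bcost b + 1\<close> in the conclusion pays
  for the last, failing test.\<close>
proof (induction "\<Phi> s" arbitrary: s rule: less_induct)
  case less
  show ?case
  proof (cases "bval b s")
    case False
    then have "exec (While b P) s (bcost b + 1) s" by (rule exec_WhileFalse)
    with False less.prems show ?thesis unfolding wp_def by fastforce
  next
    case True
    obtain t s' where 1: "exec P s t s'" "I s'" "t + \<Phi> s' + bcost b + 1 \<le> \<Phi> s"
      using assms(2)[OF less.prems True] unfolding wp_def by blast
    obtain u s'' where 2: "exec (While b P) s' u s''" "I s''" "\<not> bval b s''"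
      "u + \<Phi> s'' \<le> \<Phi> s' + bcost b + 1"
      using less.hyps[of s'] 1 unfolding wp_def by auto
    have "exec (While b P) s (bcost b + 1 + t + u) s''"
      using exec_WhileTrue[OF True 1(1) 2(1)] .
    moreover have "bcost b + 1 + t + u + \<Phi> s'' \<le> \<Phi> s + bcost b + 1"
      using 1(3) 2(4) by linarith
    ultimately show ?thesis using 2(2,3) unfolding wp_def by blast
  qed
qed

definition frame :: "nat set \<Rightarrow> nat set \<Rightarrow> state \<Rightarrow> state \<Rightarrow> bool" where
  "frame Rs As s s' \<longleftrightarrow>
     (\<forall>r. r \<notin> Rs \<longrightarrow> regs s' r = regs s r) \<and> (\<forall>a. a \<notin> As \<longrightarrow> arrs s' a = arrs s a)"

lemma frame_trans:
  "frame Rs As s s' \<Longrightarrow> frame Rs' As' s' s'' \<Longrightarrow> Rs \<union> Rs' \<subseteq> Rs'' \<Longrightarrow> As \<union> As' \<subseteq> As''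
   \<Longrightarrow> frame Rs'' As'' s s''"
  unfolding frame_def by (metis Un_iff subsetD)

section \<open>Breadth-first search\<close>

text \<open>Abstracts the two input arrays from the lists behind them. \<open>M\<close> bounds the
  sum of the degrees.\<close>

locale indexed_graph =
  fixes n k M :: nat and off ad :: "nat \<Rightarrow> nat"
  assumes off_mono: "u < n \<Longrightarrow> off u \<le> off (Suc u)"
    and sum_deg: "(\<Sum>u<n. off (Suc u) - off u) \<le> M"
    and ad_less: "u < n \<Longrightarrow> ad ` {off u..<off (Suc u)} \<subseteq> {..<n}"
    and ad_sym: "u < n \<Longrightarrow> v < n \<Longrightarrow> v \<in> ad ` {off u..<off (Suc u)} \<Longrightarrow> u \<in> ad ` {off v..<off (Suc v)}"
begin

section \<open>Components after deletion of vertices\<close>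

definition N :: "nat \<Rightarrow> nat set" where
  "N u = ad ` {off u..<off (Suc u)}"

definition link :: "nat set \<Rightarrow> nat rel" where
  "link D = {(x, y). x < n \<and> y < n \<and> x \<notin> D \<and> y \<notin> D \<and> y \<in> N x}"

definition comp :: "nat set \<Rightarrow> nat \<Rightarrow> nat set" where
  "comp D x = {y. (x, y) \<in> (link D)\<^sup>*}"

text \<open>\<open>D\<close> may contain numbers that are not vertices; this admits the dummy
  \<open>n\<close> of the search tree.\<close>

definition fractured :: "nat set \<Rightarrow> bool" where
  "fractured D \<longleftrightarrow> (\<forall>x<n. x \<notin> D \<longrightarrow> card (comp D x) \<le> k)"

lemma sym_link: "sym ((link D)\<^sup>*)"
  by (rule sym_rtrancl) (auto simp: link_def N_def sym_def intro: ad_sym)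

lemma link_antimono: "D \<subseteq> E \<Longrightarrow> link E \<subseteq> link D"
  by (auto simp: link_def)

lemma comp_subset: "x < n \<Longrightarrow> comp D x \<subseteq> {..<n}"
  by (auto simp: comp_def link_def elim: rtranclE)

lemma comp_eq: "(x, y) \<in> (link D)\<^sup>* \<Longrightarrow> comp D x = comp D y"
  unfolding comp_def using sym_link[of D] by (auto dest: symD intro: rtrancl_trans)

lemma comp_antimono: "D \<subseteq> E \<Longrightarrow> comp E x \<subseteq> comp D x"
  unfolding comp_def using rtrancl_mono[OF link_antimono] by blast

text \<open>Components only shrink when more is deleted. This makes padding harmless.\<close>

lemma fractured_mono: "fractured D \<Longrightarrow> D \<subseteq> E \<Longrightarrow> fractured E"
  unfolding fractured_def
  by (metis card_mono comp_antimono comp_subset finite_lessThan finite_subset le_trans subsetD)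

text \<open>The state of a breadth-first search of the graph without \<open>D\<close>: the queue \<open>Q\<close> has head
  \<open>h\<close> and tail \<open>t\<close>, all vertices below \<open>s\<close> have been tried as roots, the current component starts at
  position \<open>b\<close> of the queue, and \<open>j\<close> points into the adjacency list of \<open>Q h\<close>.\<close>

definition bfs :: "nat set \<Rightarrow> (nat \<Rightarrow> nat) \<Rightarrow> nat \<Rightarrow> nat \<Rightarrow> nat \<Rightarrow> nat \<Rightarrow> nat \<Rightarrow> bool" where
  "bfs D Q s h t b j \<longleftrightarrow>
     b \<le> h \<and> h \<le> t \<and> s \<le> n \<and> t \<le> b + k + 1 \<and>
     inj_on Q {..<t} \<and> Q ` {..<t} \<subseteq> {..<n} - D \<and>
     {..<s} \<subseteq> D \<union> Q ` {..<t} \<and>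
     (\<forall>i<h. N (Q i) \<subseteq> D \<union> Q ` {..<t}) \<and>
     (h < t \<longrightarrow> off (Q h) \<le> j \<and> j \<le> off (Suc (Q h)) \<and> ad ` {off (Q h)..<j} \<subseteq> D \<union> Q ` {..<t}) \<and>
     (\<forall>i. b < i \<longrightarrow> i < t \<longrightarrow> (\<exists>i'. b \<le> i' \<and> i' < i \<and> Q i \<in> N (Q i'))) \<and>
     (\<forall>i<b. N (Q i) \<subseteq> D \<union> Q ` {..<b}) \<and> (\<forall>i<b. card (comp D (Q i)) \<le> k)"

text \<open>The number of adjacency entries read so far, a progress measure for the search. With an
  empty queue \<open>j\<close> carries no information, hence the case distinction.\<close>

definition scanned :: "(nat \<Rightarrow> nat) \<Rightarrow> nat \<Rightarrow> nat \<Rightarrow> nat \<Rightarrow> nat" where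
  "scanned Q h t j = (\<Sum>i<h. off (Suc (Q i)) - off (Q i)) + (if h < t then j - off (Q h) else 0)"

section \<open>Steps of the search and their effect on the invariant\<close>

lemma bfs_init: "bfs D Q 0 0 0 0 j"
  by (simp add: bfs_def)

lemma bfs_tail_le: "bfs D Q s h t b j \<Longrightarrow> t \<le> n"
  by (metis Diff_subset bfs_def card_inj_on_le card_lessThan finite_lessThan subset_trans)

lemma image_upd_tail: "Q(t := w) ` {..<Suc t} = insert w (Q ` {..<(t::nat)})"
  by (auto simp: lessThan_Suc image_iff)

lemma inj_upd_tail:
  "inj_on Q {..<t} \<Longrightarrow> w \<notin> Q ` {..<t} \<Longrightarrow> inj_on (Q(t := w)) {..<Suc (t::nat)}"
  by (simp add: lessThan_Suc inj_on_fun_updI)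

text \<open>The queue never repeats a vertex, so every adjacency list is read at most once.\<close>

lemma scanned_le:
  assumes "bfs D Q s h t b j"
  shows "scanned Q h t j \<le> M"
proof -
  let ?g = "\<lambda>u. off (Suc u) - off u"
  have inj: "inj_on Q {..<t}" and sub: "Q ` {..<t} \<subseteq> {..<n}" and ht: "h \<le> t"
    using assms by (auto simp: bfs_def)
  have "scanned Q h t j \<le> (\<Sum>i<t. ?g (Q i))"
  proof (cases "h < t")
    case True
    have "j \<le> off (Suc (Q h))" using assms True by (simp add: bfs_def)
    then have "scanned Q h t j \<le> (\<Sum>i<Suc h. ?g (Q i))" using True by (simp add: scanned_def)
    also have "\<dots> \<le> (\<Sum>i<t. ?g (Q i))" by (rule sum_mono2) (use True in auto)
    finally show ?thesis .
  next
    case False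
    then show ?thesis using ht by (simp add: scanned_def)
  qed
  also have "\<dots> = sum ?g (Q ` {..<t})" using inj by (simp add: sum.reindex)
  also have "\<dots> \<le> (\<Sum>u<n. ?g u)" by (rule sum_mono2) (use sub in auto)
  finally show ?thesis using sum_deg by simp
qed

lemma bfs_edge_seen:
  assumes "bfs D Q s h t b j" "h < t" "j < off (Suc (Q h))" "ad j \<in> D \<union> Q ` {..<t}"
  shows "bfs D Q s h t b (Suc j)" "scanned Q h t (Suc j) = Suc (scanned Q h t j)"
proof -
  have j: "off (Q h) \<le> j" using assms by (simp add: bfs_def)
  then have "ad ` {off (Q h)..<Suc j} = insert (ad j) (ad ` {off (Q h)..<j})"
    by (simp add: atLeastLessThanSuc)
  then show "bfs D Q s h t b (Suc j)" using assms by (simp add: bfs_def)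
  show "scanned Q h t (Suc j) = Suc (scanned Q h t j)"
    using j assms(2) by (simp add: scanned_def)
qed

lemma edge_less:
  assumes "bfs D Q s h t b j" "h < t" "j < off (Suc (Q h))"
  shows "ad j \<in> N (Q h)" "ad j < n"
proof -
  show 1: "ad j \<in> N (Q h)" using assms by (auto simp: bfs_def N_def)
  have "Q h < n" using assms by (auto simp: bfs_def)
  with 1 show "ad j < n" using ad_less by (auto simp: N_def)
qed

lemma bfs_edge_new:
  assumes "bfs D Q s h t b j" "h < t" "j < off (Suc (Q h))" "ad j \<notin> D \<union> Q ` {..<t}" "t < b + k + 1"
  shows "bfs D (Q(t := ad j)) s h (Suc t) b (Suc j)"
    "scanned (Q(t := ad j)) h (Suc t) (Suc j) = Suc (scanned Q h t j)"
proof -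
  note 1 = edge_less[OF assms(1-3)]
  have 2: "(Q(t := ad j)) i = Q i" if "i < t" for i using that by simp
  have bt: "b < t" "b \<le> h" using assms by (auto simp: bfs_def)
  have img: "(Q(t := ad j)) ` {..<b} = Q ` {..<b}" using bt by (intro image_cong) auto
  have inj: "inj_on (Q(t := ad j)) {..<Suc t}"
    using assms by (intro inj_upd_tail) (auto simp: bfs_def)
  have par0: "\<And>i. b < i \<Longrightarrow> i < t \<Longrightarrow> \<exists>i'. b \<le> i' \<and> i' < i \<and> Q i \<in> N (Q i')"
    using assms(1) by (simp add: bfs_def)
  have par: "\<exists>i'. b \<le> i' \<and> i' < i \<and> (Q(t := ad j)) i \<in> N ((Q(t := ad j)) i')"
    if bi: "b < i" "i < Suc t" for i
  proof (cases "i = t")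
    case True
    \<comment> \<open>The new entry was found from the head of the queue, which lies in the current
      component.\<close>
    then show ?thesis using 1 bt assms(2) by (intro exI[of _ h]) auto
  next
    case False
    then have "i < t" using bi by simp
    then obtain i' where "b \<le> i'" "i' < i" "Q i \<in> N (Q i')" using par0 bi(1) by blast
    then show ?thesis using \<open>i < t\<close> by (intro exI[of _ i']) auto
  qed
  have old: "b \<le> h" "h \<le> t" "s \<le> n" "Q ` {..<t} \<subseteq> {..<n} - D" "{..<s} \<subseteq> D \<union> Q ` {..<t}"
    "\<And>i. i<h \<Longrightarrow> N (Q i) \<subseteq> D \<union> Q ` {..<t}" "off (Q h) \<le> j" 
    "ad ` {off (Q h)..<j} \<subseteq> D \<union> Q ` {..<t}"
    "\<And>i. i < b \<Longrightarrow> N (Q i) \<subseteq> D \<union> Q ` {..<b}" "\<And>i. i < b \<Longrightarrow> card (comp D (Q i)) \<le> k"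
    using assms(1,2) by (simp_all add: bfs_def)
  have "ad ` {off (Q h)..<Suc j} = insert (ad j) (ad ` {off (Q h)..<j})"
    using old(7) by (simp add: atLeastLessThanSuc)
  then have "ad ` {off ((Q(t := ad j)) h)..<Suc j} \<subseteq> D \<union> insert (ad j) (Q ` {..<t})"
    using old(8) 2[OF assms(2)] by auto
  moreover have "\<forall>i<h. N ((Q(t := ad j)) i) \<subseteq> D \<union> insert (ad j) (Q ` {..<t})"
    using old(6) assms(2) by auto
  moreover have "\<forall>i<b. N ((Q(t := ad j)) i) \<subseteq> D \<union> Q ` {..<b} \<and> card (comp D ((Q(t := ad j)) i)) \<le> k"
    using old(9,10) bt by simp
  moreover have "insert (ad j) (Q ` {..<t}) \<subseteq> {..<n} - D" "{..<s} \<subseteq> D \<union> insert (ad j) (Q ` {..<t})"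
    using old(4,5) 1 assms(4) by auto
  moreover have "off ((Q(t := ad j)) h) \<le> Suc j" "Suc j \<le> off (Suc ((Q(t := ad j)) h))"
    using old(7) assms(2,3) by simp_all
  ultimately show "bfs D (Q(t := ad j)) s h (Suc t) b (Suc j)"
    unfolding bfs_def image_upd_tail img
    using inj par old(1-3) assms(5) by (simp del: fun_upd_apply)
  show "scanned (Q(t := ad j)) h (Suc t) (Suc j) = Suc (scanned Q h t j)"
    using assms old(7) by (auto simp: scanned_def)
qed

text \<open>The list of the head has been read completely. If the queue becomes empty, the new
  position comes from a cell beyond the tail; invariant and measure ignore it then.\<close>

lemma bfs_advance:
  assumes "bfs D Q s h t b j" "h < t" "\<not> j < off (Suc (Q h))"
  shows "bfs D Q s (Suc h) t b (off (Q (Suc h)))"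
    "scanned Q (Suc h) t (off (Q (Suc h))) = scanned Q h t j"
proof -
  have j: "j = off (Suc (Q h))" using assms by (auto simp: bfs_def)
  have "off (Q (Suc h)) \<le> off (Suc (Q (Suc h)))" if "Suc h < t"
    using that assms(1) by (intro off_mono) (auto simp: bfs_def)
  then show "bfs D Q s (Suc h) t b (off (Q (Suc h)))"
    using assms(1,2) unfolding bfs_def j by (auto simp: less_Suc_eq N_def)
  show "scanned Q (Suc h) t (off (Q (Suc h))) = scanned Q h t j"
    using assms by (simp add: scanned_def j)
qed

text \<open>Parents sit at earlier positions, so following them ends at position \<open>b\<close>.
  The set \<open>S\<close> is general: it is the deleted set when a component is completed, and a
  hypothetical solution when the search overflows.\<close>

lemma bfs_parent_reach:
  fixes b m :: nat
  assumes "\<And>i. b < i \<Longrightarrow> i \<le> m \<Longrightarrow> \<exists>i'. b \<le> i' \<and> i' < i \<and> Q i \<in> N (Q i')"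
    and "\<And>i. b \<le> i \<Longrightarrow> i \<le> m \<Longrightarrow> Q i < n \<and> Q i \<notin> S" and "b \<le> m"
  shows "(Q b, Q m) \<in> (link S)\<^sup>*"
  using assms
proof (induction m rule: less_induct)
  case (less m)
  show ?case
  proof (cases "b = m")
    case False
    then obtain i' where i: "b \<le> i'" "i' < m" "Q m \<in> N (Q i')" using less.prems(1)[of m] less.prems(3) by auto
    have "(Q b, Q i') \<in> (link S)\<^sup>*" using less.prems i by (intro less.IH) auto
    moreover have "(Q i', Q m) \<in> link S" using less.prems i by (auto simp: link_def)
    ultimately show ?thesis by simp
  qed simp
qed

text \<open>When the queue runs empty it is closed under neighbours outside \<open>D\<close>, so the
  positions from \<open>b\<close> to \<open>t\<close> hold the whole component of
  \<open>Q b\<close>, at most \<open>k\<close> vertices by the bound on \<open>t\<close>.\<close>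

lemma bfs_close:
  assumes "bfs D Q s t t b j" "t < b + k + 1"
  shows "bfs D Q s t t t j'"
proof -
  have sub: "Q ` {..<t} \<subseteq> {..<n} - D" and inj: "inj_on Q {..<t}" and bt: "b \<le> t"
    and cl: "\<And>i. i < t \<Longrightarrow> N (Q i) \<subseteq> D \<union> Q ` {..<t}"
    and clb: "\<And>i. i < b \<Longrightarrow> N (Q i) \<subseteq> D \<union> Q ` {..<b}"
    and cb: "\<And>i. i < b \<Longrightarrow> card (comp D (Q i)) \<le> k"
    and par: "\<And>i. b < i \<Longrightarrow> i < t \<Longrightarrow> \<exists>i'. b \<le> i' \<and> i' < i \<and> Q i \<in> N (Q i')"
    using assms by (auto simp only: bfs_def simp_thms)
  have stay: "y \<in> Q ` {..<m}" if "(x, y) \<in> (link D)\<^sup>*" "x \<in> Q ` {..<m}"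
    "\<And>i. i < m \<Longrightarrow> N (Q i) \<subseteq> D \<union> Q ` {..<m}" for x y m
    using that by (induction rule: rtrancl_induct) (auto simp: link_def)
  have "card (comp D (Q i)) \<le> k" if i: "i < t" for i
  proof (cases "i < b")
    case False
    have "(Q b, Q i) \<in> (link D)\<^sup>*"
      using par i False sub by (intro bfs_parent_reach[of b i Q]) (auto simp: image_subset_iff)
    then have eq: "comp D (Q i) = comp D (Q b)" using comp_eq by simp
    have "comp D (Q b) \<subseteq> Q ` {b..<t}"
    proof
      fix y assume "y \<in> comp D (Q b)"
      then have y: "(Q b, y) \<in> (link D)\<^sup>*" by (simp add: comp_def)
      have "y \<in> Q ` {..<t}" using stay[OF y _ cl] i False by auto
      \<comment> \<open>The part before \<open>b\<close> is closed too and reachability is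
        symmetric: if \<open>y\<close> were there, \<open>Q b\<close> would be as well, against
        injectivity.\<close>
      moreover have "y \<notin> Q ` {..<b}"
      proof
        assume "y \<in> Q ` {..<b}"
        then have "Q b \<in> Q ` {..<b}" using stay[OF _ _ clb] y sym_link by (metis symD)
        then show False using inj i False unfolding inj_on_def by fastforce
      qed
      ultimately show "y \<in> Q ` {b..<t}" by (force simp: image_iff not_less)
    qed
    then have "card (comp D (Q b)) \<le> card (Q ` {b..<t})" by (intro card_mono) auto
    also have "\<dots> \<le> t - b" using card_image_le[of "{b..<t}" Q] by simp
    finally show ?thesis using assms(2) eq by simp
  qed (use cb in simp)
  then show ?thesis using assms(1) cl by (auto simp: bfs_def)
qed

text \<open>The component start moves to \<open>t\<close> even if the root is rejected, which leaves
  an empty current component.\<close>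

lemma bfs_skip_root:
  assumes "bfs D Q s t t b j" "t < b + k + 1" "s < n" "s \<in> D \<union> Q ` {..<t}"
  shows "bfs D Q (Suc s) t t t j'"
  using bfs_close[OF assms(1,2), of j'] assms(3,4) by (simp add: bfs_def lessThan_Suc)

lemma bfs_new_root:
  assumes "bfs D Q s t t b j" "t < b + k + 1" "s < n" "s \<notin> D \<union> Q ` {..<t}"
  shows "bfs D (Q(t := s)) (Suc s) t (Suc t) t (off s)"
    "scanned (Q(t := s)) t (Suc t) (off s) = scanned Q t t j"
proof -
  note 1 = bfs_close[OF assms(1,2), of 0]
  have img: "(Q(t := s)) ` {..<t} = Q ` {..<t}" by (intro image_cong) auto
  have inj: "inj_on (Q(t := s)) {..<Suc t}"
    using 1 assms by (intro inj_upd_tail) (auto simp: bfs_def)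
  show "bfs D (Q(t := s)) (Suc s) t (Suc t) t (off s)"
    unfolding bfs_def image_upd_tail img
    using inj 1 assms(3,4) off_mono[of s] by (auto simp: bfs_def lessThan_Suc)
  show "scanned (Q(t := s)) t (Suc t) (off s) = scanned Q t t j"
    by (simp add: scanned_def)
qed

lemma bfs_exhausted:
  assumes "bfs D Q n t t b j" "t < b + k + 1"
  shows "fractured D"
proof -
  have "{..<n} \<subseteq> D \<union> Q ` {..<t}" "\<forall>i<t. card (comp D (Q i)) \<le> k"
    using bfs_close[OF assms, of 0] by (simp_all add: bfs_def)
  then show ?thesis unfolding fractured_def by blast
qed

text \<open>The branching rule. If \<open>S\<close> missed all \<open>k + 1\<close> vertices found,
  their parent paths would survive the deletion of \<open>S\<close> and lie in one component with
  more than \<open>k\<close> vertices.\<close>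

lemma bfs_overflow:
  assumes "bfs D Q s h t b j" "t = b + k + 1" "fractured S" "D \<subseteq> S"
  shows "\<exists>i\<le>k. Q (b + i) \<in> S"
proof (rule ccontr)
  assume neg: "\<not> ?thesis"
  have sub: "Q ` {..<t} \<subseteq> {..<n} - D" and inj: "inj_on Q {..<t}"
    and par: "\<And>i. b < i \<Longrightarrow> i < t \<Longrightarrow> \<exists>i'. b \<le> i' \<and> i' < i \<and> Q i \<in> N (Q i')"
    using assms(1) by (auto simp only: bfs_def simp_thms)
  have out: "Q i < n \<and> Q i \<notin> S" if "b \<le> i" "i < t" for i
  proof -
    have "i = b + (i - b)" "i - b \<le> k" using that assms(2) by auto
    then have "Q i \<notin> S" using neg by metis
    then show ?thesis using sub that by auto
  qed
  have "Q ` {b..<t} \<subseteq> comp S (Q b)"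
    unfolding comp_def using out par by (auto intro!: bfs_parent_reach[where Q = Q])
  moreover have "finite (comp S (Q b))"
    using comp_subset[of "Q b" S] out[of b] assms(2) by (auto intro: finite_subset)
  ultimately have "card (Q ` {b..<t}) \<le> card (comp S (Q b))" by (rule card_mono[rotated])
  moreover have "card (Q ` {b..<t}) = k + 1"
    using inj assms(2) by (subst card_image) (auto intro: inj_on_subset)
  moreover have "card (comp S (Q b)) \<le> k" using assms(2,3) out[of b] by (simp add: fractured_def)
  ultimately show False by simp
qed

end

section \<open>The program\<close>

definition clear :: com where
  "clear = Seq (Assign 6 (Const 0)) (While (Less (Reg 6) (Reg 0))
     (Seq (Store 3 (Reg 6) (Const 0)) (Assign 6 (Plus (Reg 6) (Const 1)))))"

lemma wp_clear:
  "wp clear (\<lambda>t s'. t \<le> 20 * (regs s 0 + 1) \<and> frame {6} {3} s s' \<and>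
     (\<forall>x<regs s 0. arrs s' 3 x = 0)) s"
proof -
  let ?I = "\<lambda>s'. frame {6} {3} s s' \<and> regs s' 6 \<le> regs s 0 \<and> (\<forall>x<regs s' 6. arrs s' 3 x = 0)"
  \<comment> \<open>One round including its guard costs less than 15; constants in later bounds are
    generous in the same way.\<close>
  let ?\<Phi> = "\<lambda>s'. 15 * (regs s 0 - regs s' 6)"
  let ?s = "s\<lparr>regs := (regs s)(6 := 0)\<rparr>"
  have "?I ?s" by (simp add: frame_def)
  then have "wp (While (Less (Reg 6) (Reg 0))
     (Seq (Store 3 (Reg 6) (Const 0)) (Assign 6 (Plus (Reg 6) (Const 1)))))
     (\<lambda>t s'. ?I s' \<and> \<not> bval (Less (Reg 6) (Reg 0)) s' \<and>
        t + ?\<Phi> s' \<le> ?\<Phi> ?s + bcost (Less (Reg 6) (Reg 0)) + 1) ?s"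
    by (rule wp_While) (rule wp_simple | auto simp: frame_def less_Suc_eq)+
  then show ?thesis unfolding clear_def
    apply (intro wp_Seq wp_Assign)
    apply simp
    apply (erule wp_mono)
    by (auto simp: frame_def)
qed

text \<open>The range includes cell \<open>d\<close>, so the dummy is marked too; its mark lies
  beyond those of the \<open>n\<close> vertices.\<close>

definition mark :: com where
  "mark = Seq (Assign 6 (Reg 5)) (While (Less (Reg 6) (Plus (Reg 2) (Const 1)))
     (Seq (Store 3 (Cell 2 (Reg 6)) (Const 1)) (Assign 6 (Plus (Reg 6) (Const 1)))))"

lemma wp_mark:
  assumes "regs s 5 \<le> regs s 2"
  shows "wp mark (\<lambda>t s'. t \<le> 20 * (regs s 2 + 2) \<and> frame {6} {3} s s' \<and>
     (\<forall>x. arrs s' 3 x = (if x \<in> arrs s 2 ` {regs s 5..regs s 2} then 1 else arrs s 3 x))) s"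
proof -
  let ?I = "\<lambda>s'. frame {6} {3} s s' \<and> regs s 5 \<le> regs s' 6 \<and> regs s' 6 \<le> Suc (regs s 2) \<and>
     (\<forall>x. arrs s' 3 x = (if x \<in> arrs s 2 ` {regs s 5..<regs s' 6} then 1 else arrs s 3 x))"
  let ?\<Phi> = "\<lambda>s'. 17 * (Suc (regs s 2) - regs s' 6)"
  let ?s = "s\<lparr>regs := (regs s)(6 := regs s 5)\<rparr>"
  have "?I ?s" using assms by (simp add: frame_def)
  then have "wp (While (Less (Reg 6) (Plus (Reg 2) (Const 1)))
     (Seq (Store 3 (Cell 2 (Reg 6)) (Const 1)) (Assign 6 (Plus (Reg 6) (Const 1)))))
     (\<lambda>t s'. ?I s' \<and> \<not> bval (Less (Reg 6) (Plus (Reg 2) (Const 1))) s' \<and>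
        t + ?\<Phi> s' \<le> ?\<Phi> ?s + bcost (Less (Reg 6) (Plus (Reg 2) (Const 1))) + 1) ?s"
    by (rule wp_While) (rule wp_simple | auto simp: frame_def atLeastLessThanSuc)+
  then show ?thesis unfolding mark_def
    apply (intro wp_Seq wp_Assign)
    apply simp
    apply (erule wp_mono)
    using assms by (auto simp: frame_def atLeastLessThanSuc_atLeastAtMost[symmetric] dest!: le_antisym[OF _ leI])
qed

text \<open>The nested negations express a disjunction: a queued vertex or an untried root is left.
  The first conjunct stops the search at \<open>k + 1\<close> vertices in one component.\<close>

definition bfs_guard :: bexp where
  "bfs_guard = Conj (Less (Reg 8) (Plus (Plus (Reg 9) (Reg 1)) (Const 1)))
     (Neg (Conj (Neg (Less (Reg 7) (Reg 8))) (Neg (Less (Reg 6) (Reg 0)))))"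

text \<open>All nested loops are flattened into one: an iteration handles one adjacency entry, one
  removal from the queue or one root, so it has constant cost.\<close>

definition bfs_step :: com where
  "bfs_step = Cond (Less (Reg 7) (Reg 8))
     (Cond (Less (Reg 10) (Cell 0 (Plus (Cell 4 (Reg 7)) (Const 1))))
       (Seq (Assign 11 (Cell 1 (Reg 10)))
         (Seq (Cond (Equal (Cell 3 (Reg 11)) (Const 0))
            (Seq (Store 3 (Reg 11) (Const 2))
              (Seq (Store 4 (Reg 8) (Reg 11)) (Assign 8 (Plus (Reg 8) (Const 1)))))
            Skip)
          (Assign 10 (Plus (Reg 10) (Const 1)))))
       (Seq (Assign 7 (Plus (Reg 7) (Const 1))) (Assign 10 (Cell 0 (Cell 4 (Reg 7))))))
     (Seq (Assign 9 (Reg 8))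
       (Seq (Cond (Equal (Cell 3 (Reg 6)) (Const 0))
          (Seq (Store 3 (Reg 6) (Const 2))
            (Seq (Store 4 (Reg 8) (Reg 6))
              (Seq (Assign 8 (Plus (Reg 8) (Const 1))) (Assign 10 (Cell 0 (Reg 6))))))
          Skip)
        (Assign 6 (Plus (Reg 6) (Const 1)))))"

text \<open>Register 10 keeps its old value: with an empty queue the invariant puts no condition on
  \<open>j\<close>.\<close>

definition search :: com where
  "search = Seq (Assign 6 (Const 0)) (Seq (Assign 7 (Const 0)) (Seq (Assign 8 (Const 0))
     (Seq (Assign 9 (Const 0)) (While bfs_guard bfs_step))))"

definition push :: com where
  "push = Seq (Assign 6 (Const 0)) (While (Less (Reg 6) (Plus (Reg 1) (Const 1)))
     (Seq (Store 5 (Reg 4) (Minus (Reg 5) (Const 1)))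
       (Seq (Store 6 (Reg 4) (Cell 4 (Plus (Reg 9) (Reg 6))))
         (Seq (Assign 4 (Plus (Reg 4) (Const 1))) (Assign 6 (Plus (Reg 6) (Const 1)))))))"

lemma wp_push:
  "wp push (\<lambda>t s'. t \<le> 40 * (regs s 1 + 2) \<and> frame {4, 6} {5, 6} s s' \<and>
     regs s' 4 = regs s 4 + regs s 1 + 1 \<and>
     (\<forall>x. arrs s' 5 x = (if regs s 4 \<le> x \<and> x < regs s' 4 then regs s 5 - 1 else arrs s 5 x)) \<and>
     (\<forall>x. arrs s' 6 x = (if regs s 4 \<le> x \<and> x < regs s' 4
        then arrs s 4 (regs s 9 + (x - regs s 4)) else arrs s 6 x))) s"
proof -
  let ?b = "Less (Reg 6) (Plus (Reg 1) (Const 1))"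
  let ?I = "\<lambda>s'. frame {4, 6} {5, 6} s s' \<and> regs s' 6 \<le> regs s 1 + 1 \<and>
     regs s' 4 = regs s 4 + regs s' 6 \<and>
     (\<forall>x. arrs s' 5 x = (if regs s 4 \<le> x \<and> x < regs s' 4 then regs s 5 - 1 else arrs s 5 x)) \<and>
     (\<forall>x. arrs s' 6 x = (if regs s 4 \<le> x \<and> x < regs s' 4
        then arrs s 4 (regs s 9 + (x - regs s 4)) else arrs s 6 x))"
  let ?\<Phi> = "\<lambda>s'. 35 * (regs s 1 + 1 - regs s' 6)"
  let ?s = "s\<lparr>regs := (regs s)(6 := 0)\<rparr>"
  have "?I ?s" by (simp add: frame_def)
  moreover have "wp (Seq (Store 5 (Reg 4) (Minus (Reg 5) (Const 1)))
       (Seq (Store 6 (Reg 4) (Cell 4 (Plus (Reg 9) (Reg 6))))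
         (Seq (Assign 4 (Plus (Reg 4) (Const 1))) (Assign 6 (Plus (Reg 6) (Const 1))))))
     (\<lambda>t s''. ?I s'' \<and> t + ?\<Phi> s'' + bcost ?b + 1 \<le> ?\<Phi> s') s'"
    if I: "?I s'" and b: "bval ?b s'" for s'
  proof -
    have fr: "frame {4, 6} {5, 6} s s'" and "regs s' 6 \<le> regs s 1"
      and top: "regs s' 4 = regs s 4 + regs s' 6"
      using I b by (auto simp: frame_def)
    moreover have "regs s' 5 = regs s 5" "regs s' 9 = regs s 9" "arrs s' 4 = arrs s 4"
      using fr by (auto simp: frame_def)
    ultimately show ?thesis
      using I by - (rule wp_simple | simp add: frame_def less_Suc_eq)+
  qed
  ultimately have "wp (While ?b (Seq (Store 5 (Reg 4) (Minus (Reg 5) (Const 1)))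
       (Seq (Store 6 (Reg 4) (Cell 4 (Plus (Reg 9) (Reg 6))))
         (Seq (Assign 4 (Plus (Reg 4) (Const 1))) (Assign 6 (Plus (Reg 6) (Const 1)))))))
     (\<lambda>t s'. ?I s' \<and> \<not> bval ?b s' \<and> t + ?\<Phi> s' \<le> ?\<Phi> ?s + bcost ?b + 1) ?s"
    by (rule wp_While)
  then show ?thesis unfolding push_def
    apply (intro wp_Seq wp_Assign)
    apply simp
    apply (erule wp_mono)
    by (auto simp: frame_def)
qed

section \<open>Correctness and linear running time of one search\<close>

context indexed_graph
begin

definition loaded :: "state \<Rightarrow> bool" where
  "loaded s \<longleftrightarrow> arrs s 0 = off \<and> arrs s 1 = ad \<and> regs s 0 = n \<and> regs s 1 = k"

definition visited :: "nat set \<Rightarrow> (nat \<Rightarrow> nat) \<Rightarrow> (nat \<Rightarrow> nat) \<Rightarrow> nat \<Rightarrow> bool" where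
  "visited D vis Q t \<longleftrightarrow>
     (\<forall>x<n. vis x = (if x \<in> D then 1 else if x \<in> Q ` {..<t} then 2 else 0))"

definition bfs_state :: "nat set \<Rightarrow> state \<Rightarrow> bool" where
  "bfs_state D s \<longleftrightarrow> loaded s \<and> visited D (arrs s 3) (arrs s 4) (regs s 8) \<and>
     bfs D (arrs s 4) (regs s 6) (regs s 7) (regs s 8) (regs s 9) (regs s 10)"

text \<open>One counter per kind of iteration: untried roots, vertices not yet removed from the
  queue, unread adjacency entries.\<close>

definition bfs_todo :: "state \<Rightarrow> nat" where
  "bfs_todo s = (n - regs s 6) + (n - regs s 7) +
     (M - scanned (arrs s 4) (regs s 7) (regs s 8) (regs s 10))"

lemma wp_bfs_step:
  assumes "bfs_state D s" "bval bfs_guard s"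
  shows "wp bfs_step (\<lambda>t s'. t \<le> 60 \<and> bfs_state D s' \<and> frame {6..11} {3, 4} s s' \<and>
    bfs_todo s' < bfs_todo s) s"
proof -
  let ?Q = "arrs s 4" and ?s = "regs s 6" and ?h = "regs s 7" and ?t = "regs s 8"
    and ?b = "regs s 9" and ?j = "regs s 10"
  have ld: "arrs s 0 = off" "arrs s (Suc 0) = ad" "regs s 0 = n" "regs s (Suc 0) = k"
    and vis: "visited D (arrs s 3) ?Q ?t" and inv: "bfs D ?Q ?s ?h ?t ?b ?j"
    using assms(1) by (auto simp: bfs_state_def loaded_def)
  have lt: "?t < ?b + k + 1" and more: "?h < ?t \<or> ?s < n"
    using assms(2) ld by (auto simp: bfs_guard_def)
  have tn: "?t \<le> n" using bfs_tail_le[OF inv] .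
  have seen: "arrs s 3 x = 0 \<longleftrightarrow> x \<notin> D \<union> ?Q ` {..<?t}" if "x < n" for x
    using vis that by (auto simp: visited_def)
  have push: "visited D ((arrs s 3)(w := 2)) (?Q(?t := w)) (Suc ?t)" if "w \<notin> D \<union> ?Q ` {..<?t}" for w
    using vis that unfolding visited_def image_upd_tail by auto
  consider "?h < ?t" "?j < off (Suc (?Q ?h))" "ad ?j \<in> D \<union> ?Q ` {..<?t}"
    | "?h < ?t" "?j < off (Suc (?Q ?h))" "ad ?j \<notin> D \<union> ?Q ` {..<?t}"
    | "?h < ?t" "\<not> ?j < off (Suc (?Q ?h))"
    | "?h = ?t" "?s < n" "?s \<in> D \<union> ?Q ` {..<?t}"
    | "?h = ?t" "?s < n" "?s \<notin> D \<union> ?Q ` {..<?t}"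
    using more inv unfolding bfs_def by linarith
  then show ?thesis
  proof cases
    case 1
    note st = bfs_edge_seen[OF inv 1]
    have "arrs s 3 (ad ?j) \<noteq> 0" using seen[OF edge_less(2)[OF inv 1(1,2)]] 1(3) by simp
    \<comment> \<open>\<open>scanned_le\<close> for the new state ensures that the truncated
      difference from \<open>M\<close> strictly decreases.\<close>
    then show ?thesis unfolding bfs_step_def
      using 1(1,2) ld vis st scanned_le[OF st(1)]
      by - (rule wp_simple | simp add: bfs_state_def loaded_def bfs_todo_def frame_def)+
  next
    case 2
    note st = bfs_edge_new[OF inv 2 lt]
    have "arrs s 3 (ad ?j) = 0" using seen[OF edge_less(2)[OF inv 2(1,2)]] 2(3) by simp
    then show ?thesis unfolding bfs_step_def
      using 2(1,2) ld push[OF 2(3)] st scanned_le[OF st(1)]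
      by - (rule wp_simple | simp add: bfs_state_def loaded_def bfs_todo_def frame_def)+
  next
    case 3
    note st = bfs_advance[OF inv 3]
    \<comment> \<open>As \<open>?h < ?t\<close> and \<open>?t \<le> n\<close>, the counter
      \<open>n - regs s 7\<close> strictly decreases.\<close>
    show ?thesis unfolding bfs_step_def
      using 3 ld vis st tn
      by - (rule wp_simple | simp add: bfs_state_def loaded_def bfs_todo_def frame_def)+
  next
    case 4
    note inv' = inv[unfolded 4(1)]
    note st = bfs_skip_root[OF inv' lt 4(2,3), of ?j]
    have "arrs s 3 ?s \<noteq> 0" using seen 4 by simp
    then show ?thesis unfolding bfs_step_def
      using 4(1,2) ld vis st
      by - (rule wp_simple | simp add: bfs_state_def loaded_def bfs_todo_def frame_def)+
  next
    case 5
    note inv' = inv[unfolded 5(1)]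
    note st = bfs_new_root[OF inv' lt 5(2,3)]
    have "arrs s 3 ?s = 0" using seen 5 by simp
    then show ?thesis unfolding bfs_step_def
      using 5(1,2) ld push[OF 5(3)] st
      by - (rule wp_simple | simp add: bfs_state_def loaded_def bfs_todo_def frame_def)+
  qed
qed

lemma wp_search:
  assumes "loaded s" "\<forall>x<n. arrs s 3 x = (if x \<in> D then 1 else 0)"
  shows "wp search (\<lambda>t s'. t \<le> 100 * (2 * n + M + 1) \<and> frame {6..11} {3, 4} s s' \<and>
    (\<forall>x<n. arrs s' 3 x = 1 \<longleftrightarrow> x \<in> D) \<and>
    (if regs s' 8 < regs s' 9 + k + 1 then fractured D
     else k < n \<and> (\<forall>i\<le>k. arrs s' 4 (regs s' 9 + i) \<in> {..<n} - D) \<and>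
       (\<forall>S. fractured S \<longrightarrow> D \<subseteq> S \<longrightarrow> (\<exists>i\<le>k. arrs s' 4 (regs s' 9 + i) \<in> S)))) s"
proof -
  let ?s = "s\<lparr>regs := (regs s)(6 := 0, 7 := 0, 8 := 0, 9 := 0)\<rparr>"
  let ?I = "\<lambda>s'. bfs_state D s' \<and> frame {6..11} {3, 4} s s'"
  \<comment> \<open>A round costs at most 60 for the body and 18 + 1 for the guard.\<close>
  let ?\<Phi> = "\<lambda>s'. 80 * bfs_todo s'"
  have I0: "?I ?s"
    using assms bfs_init by (simp add: bfs_state_def loaded_def visited_def frame_def)
  have \<Phi>0: "?\<Phi> ?s \<le> 80 * (2 * n + M)" by (simp add: bfs_todo_def)
  have loop: "wp (While bfs_guard bfs_step)
    (\<lambda>t s'. ?I s' \<and> \<not> bval bfs_guard s' \<and> t + ?\<Phi> s' \<le> ?\<Phi> ?s + bcost bfs_guard + 1) ?s"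
  proof (rule wp_While[where I = ?I, OF I0])
    fix s' assume "?I s'" "bval bfs_guard s'"
    then show "wp bfs_step (\<lambda>t s''. ?I s'' \<and> t + ?\<Phi> s'' + bcost bfs_guard + 1 \<le> ?\<Phi> s') s'"
      by (intro wp_mono[OF wp_bfs_step])
        (auto simp: bfs_guard_def intro: frame_trans[where Rs' = "{6..11}" and As' = "{3,4}"])
  qed
  have post: "(\<forall>x<n. arrs s' 3 x = 1 \<longleftrightarrow> x \<in> D) \<and>
    (if regs s' 8 < regs s' 9 + k + 1 then fractured D
     else k < n \<and> (\<forall>i\<le>k. arrs s' 4 (regs s' 9 + i) \<in> {..<n} - D) \<and>
       (\<forall>S. fractured S \<longrightarrow> D \<subseteq> S \<longrightarrow> (\<exists>i\<le>k. arrs s' 4 (regs s' 9 + i) \<in> S)))"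
    if I: "bfs_state D s'" and ng: "\<not> bval bfs_guard s'" for s'
  proof -
    let ?Q = "arrs s' 4" and ?h = "regs s' 7" and ?t = "regs s' 8" and ?b = "regs s' 9"
    have inv: "bfs D ?Q (regs s' 6) ?h ?t ?b (regs s' 10)"
      and ld: "regs s' 0 = n" "regs s' (Suc 0) = k"
      using I by (simp_all add: bfs_state_def loaded_def)
    have ord: "?h \<le> ?t" "regs s' 6 \<le> n" "?t \<le> ?b + k + 1" and sub: "?Q ` {..<?t} \<subseteq> {..<n} - D"
      using inv by (simp_all add: bfs_def)
    have "arrs s' 3 x = 1 \<longleftrightarrow> x \<in> D" if "x < n" for x
      using I that by (auto simp: bfs_state_def visited_def)
    moreover have "fractured D" if "?t < ?b + k + 1"
    proof -
      have "?h = ?t" "regs s' 6 = n" using that ng ord ld by (auto simp: bfs_guard_def)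
      then show ?thesis using bfs_exhausted inv that by metis
    qed
    moreover have "k < n \<and> (\<forall>i\<le>k. ?Q (?b + i) \<in> {..<n} - D) \<and>
       (\<forall>S. fractured S \<longrightarrow> D \<subseteq> S \<longrightarrow> (\<exists>i\<le>k. ?Q (?b + i) \<in> S))" if "\<not> ?t < ?b + k + 1"
    proof -
      have t: "?t = ?b + k + 1" using that ord by simp
      have "?Q (?b + i) \<in> {..<n} - D" if "i \<le> k" for i
        using subsetD[OF sub imageI, of "?b + i"] that t by simp
      then show ?thesis using bfs_overflow[OF inv t] bfs_tail_le[OF inv] t by auto
    qed
    ultimately show ?thesis by auto
  qed
  have "bcost bfs_guard = 18" by (simp add: bfs_guard_def)
  then show ?thesis unfolding search_def
    apply -
    apply (rule wp_simple)+
    apply simp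
    apply (rule wp_mono[OF loop])
    apply (frule conjunct1)
    apply (frule conjunct2[THEN conjunct1])
    apply (drule post[OF conjunct1])
     apply assumption
    using \<Phi>0 by (simp split: if_splits)
qed

end

section \<open>The search tree\<close>

definition visit :: com where
  "visit = Seq (Assign 4 (Minus (Reg 4) (Const 1))) (Seq (Assign 5 (Cell 5 (Reg 4)))
     (Seq (Store 2 (Reg 5) (Cell 6 (Reg 4))) (Seq clear (Seq mark (Seq search
       (Cond (Less (Reg 8) (Plus (Plus (Reg 9) (Reg 1)) (Const 1)))
         (Assign 3 (Const 1))
         (Cond (Less (Const 0) (Reg 5)) push Skip)))))))"

text \<open>Reuses the marks left by the successful visit to recognise vertices that are already
  chosen.\<close>

definition pad :: com where
  "pad = Seq (Assign 6 (Const 0))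
     (While (Conj (Less (Reg 6) (Reg 0)) (Less (Const 0) (Reg 5)))
       (Seq (Cond (Equal (Cell 3 (Reg 6)) (Const 1)) Skip
          (Seq (Assign 5 (Minus (Reg 5) (Const 1))) (Store 2 (Reg 5) (Reg 6))))
        (Assign 6 (Plus (Reg 6) (Const 1)))))"

text \<open>If there are fewer than \<open>d\<close> vertices, the negative answer 0 is already in
  register 3.\<close>

definition decide :: com where
  "decide = Cond (Less (Reg 0) (Reg 2)) Skip
     (Seq (Store 5 (Const 0) (Reg 2)) (Seq (Store 6 (Const 0) (Reg 0)) (Seq (Assign 4 (Const 1))
       (Seq (While (Conj (Less (Const 0) (Reg 4)) (Equal (Reg 3) (Const 0))) visit)
         (Cond (Equal (Reg 3) (Const 1)) pad Skip)))))"

text \<open>Number of nodes of the complete \<open>b\<close>-ary tree of height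
  \<open>r\<close>.\<close>

fun tree_size :: "nat \<Rightarrow> nat \<Rightarrow> nat" where
  "tree_size b 0 = 1"
| "tree_size b (Suc r) = 1 + b * tree_size b r"

text \<open>The summand 1 on the left makes the induction work: for \<open>b \<ge> 2\<close> the two
  extra units of a step are absorbed by \<open>b * 1\<close>.\<close>

lemma tree_size_le: "2 \<le> b \<Longrightarrow> tree_size b r + 1 \<le> 2 * b ^ r"
proof (induction r)
  case (Suc r)
  have "tree_size b (Suc r) + 1 \<le> b * (tree_size b r + 1)" using Suc.prems by simp
  also have "\<dots> \<le> b * (2 * b ^ r)" using Suc by (intro mult_le_mono2) simp
  finally show ?case by simp
qed simp

lemma sum_const_tail:
  fixes f :: "nat \<Rightarrow> nat"
  assumes "\<And>i. m \<le> i \<Longrightarrow> i < m + q \<Longrightarrow> f i = c"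
  shows "(\<Sum>i<m + q. f i) = (\<Sum>i<m. f i) + q * c"
  using assms by (induction q) auto

lemma tree_size_pos: "0 < tree_size b r"
  by (cases r) simp_all

section \<open>Branches of the search tree and the stack of unvisited nodes\<close>

locale search_tree = indexed_graph +
  fixes d :: nat
  assumes d_le: "d \<le> n"
begin

text \<open>Injectivity and \<open>ch d = n\<close> force the cells from \<open>r\<close> up to
  \<open>d - 1\<close> to hold distinct proper vertices.\<close>

definition branch :: "(nat \<Rightarrow> nat) \<Rightarrow> nat \<Rightarrow> bool" where
  "branch ch r \<longleftrightarrow> r \<le> d \<and> ch d = n \<and> ch ` {r..d} \<subseteq> {..n} \<and> inj_on ch {r..d}"

text \<open>\<open>Suc d\<close> accounts for the dummy, and the inequality for later padding. So
  \<open>extendable {n}\<close> expresses that the instance is positive.\<close>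

definition extendable :: "nat set \<Rightarrow> bool" where
  "extendable D \<longleftrightarrow> (\<exists>S. D \<subseteq> S \<and> S \<subseteq> {..n} \<and> card S \<le> Suc d \<and> fractured S)"

text \<open>A stacked node is judged against the present contents of array 2, with only its own cell
  overwritten.\<close>

definition pending :: "(nat \<Rightarrow> nat) \<Rightarrow> (nat \<Rightarrow> nat) \<Rightarrow> (nat \<Rightarrow> nat) \<Rightarrow> nat \<Rightarrow> bool" where
  "pending ch R V m \<longleftrightarrow> (\<forall>i<m. branch (ch(R i := V i)) (R i)) \<and> (\<forall>j<m. \<forall>i<j. R j \<le> R i)"

definition node :: "(nat \<Rightarrow> nat) \<Rightarrow> nat \<Rightarrow> nat \<Rightarrow> nat set" where
  "node ch r v = (ch(r := v)) ` {r..d}"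

definition open_node :: "(nat \<Rightarrow> nat) \<Rightarrow> (nat \<Rightarrow> nat) \<Rightarrow> (nat \<Rightarrow> nat) \<Rightarrow> nat \<Rightarrow> bool" where
  "open_node ch R V m \<longleftrightarrow> (\<exists>i<m. extendable (node ch (R i) (V i)))"

lemma branch_cong: "(\<And>i. r \<le> i \<Longrightarrow> i \<le> d \<Longrightarrow> ch i = ch' i) \<Longrightarrow> branch ch r \<longleftrightarrow> branch ch' r"
  using inj_on_cong[of "{r..d}" ch ch'] image_cong[of "{r..d}" "{r..d}" ch ch']
  unfolding branch_def by auto

lemma node_cong: "(\<And>i. r < i \<Longrightarrow> i \<le> d \<Longrightarrow> ch i = ch' i) \<Longrightarrow> node ch r v = node ch' r v"
  unfolding node_def by (intro image_cong) auto

text \<open>A remaining node depends only on cells above its budget and on its own vertex. The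
  popped budget is no larger, so writing its cell disturbs no remaining node.\<close>

lemma pending_pop:
  assumes "pending ch R V (Suc m)"
  shows "branch (ch(R m := V m)) (R m)" "pending (ch(R m := V m)) R V m" "\<forall>i<m. R m \<le> R i"
    "open_node ch R V (Suc m) \<Longrightarrow>
       extendable ((ch(R m := V m)) ` {R m..d}) \<or> open_node (ch(R m := V m)) R V m"
proof -
  show "branch (ch(R m := V m)) (R m)" and le: "\<forall>i<m. R m \<le> R i"
    using assms by (auto simp: pending_def)
  have "branch ((ch(R m := V m))(R i := V i)) (R i) \<longleftrightarrow> branch (ch(R i := V i)) (R i)" if "i < m" for i
    using le that by (intro branch_cong) auto
  then show "pending (ch(R m := V m)) R V m" using assms by (simp add: pending_def)
  have "node (ch(R m := V m)) (R i) (V i) = node ch (R i) (V i)" if "i < m" for i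
    using le that by (intro node_cong) auto
  then show "extendable ((ch(R m := V m)) ` {R m..d}) \<or> open_node (ch(R m := V m)) R V m"
    if "open_node ch R V (Suc m)"
    using that by (auto simp: open_node_def less_Suc_eq) (simp add: node_def)
qed

lemma node_child: "branch ch (Suc r) \<Longrightarrow> node ch r v = insert v (ch ` {Suc r..d})"
proof -
  assume "branch ch (Suc r)"
  then have "{r..d} = insert r {Suc r..d}" by (auto simp: branch_def)
  then show ?thesis by (auto simp: node_def image_iff)
qed

lemma branch_child:
  assumes "branch ch (Suc r)" "v < n" "v \<notin> ch ` {Suc r..d}"
  shows "branch (ch(r := v)) r"
proof -
  have "{r..d} = insert r {Suc r..d}" using assms(1) by (auto simp: branch_def)
  moreover have "(ch(r := v)) ` {Suc r..d} = ch ` {Suc r..d}" by (intro image_cong) auto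
  moreover have "inj_on (ch(r := v)) {Suc r..d}"
    using assms(1) by (auto simp: branch_def inj_on_def)
  ultimately show ?thesis using assms by (auto simp: branch_def)
qed

text \<open>The witness is kept: it contains some \<open>C i\<close>, hence it also extends that
  child.\<close>

lemma extendable_child:
  assumes "extendable D" "\<And>S. fractured S \<Longrightarrow> D \<subseteq> S \<Longrightarrow> \<exists>i\<le>k. C i \<in> S"
  shows "\<exists>i\<le>k. extendable (insert (C i) D)"
  using assms unfolding extendable_def by (metis insert_subset)

text \<open>At budget 0 the deleted set already has \<open>Suc d\<close> elements, so a witness
  would equal it, yet it contains none of the \<open>C i\<close>.\<close>

lemma not_extendable_leaf:
  assumes "branch ch 0" "\<And>S. fractured S \<Longrightarrow> ch ` {0..d} \<subseteq> S \<Longrightarrow> \<exists>i\<le>k. C i \<in> S"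
    "\<And>i. i \<le> k \<Longrightarrow> C i \<notin> ch ` {0..d}"
  shows "\<not> extendable (ch ` {0..d})"
proof
  assume "extendable (ch ` {0..d})"
  then obtain S where S: "ch ` {0..d} \<subseteq> S" "S \<subseteq> {..n}" "card S \<le> Suc d" "fractured S"
    by (auto simp: extendable_def)
  have "card (ch ` {0..d}) = Suc d" using assms(1) by (simp add: branch_def card_image)
  then have "ch ` {0..d} = S" using S finite_subset[OF S(2)] by (intro card_seteq) auto
  then show False using assms(2)[OF S(4,1)] assms(3) by blast
qed

text \<open>The children have budget \<open>r\<close>, below every older one, so the stack stays
  ordered; as they avoid the deleted set, each continues the branch.\<close>

lemma pending_push:
  assumes "pending ch R V m" "branch ch (Suc r)" "\<forall>i<m. Suc r \<le> R i"
    "\<And>i. i \<le> k \<Longrightarrow> C i \<in> {..<n} - ch ` {Suc r..d}"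
    "\<forall>x. R' x = (if m \<le> x \<and> x < m + k + 1 then r else R x)"
    "\<forall>x. V' x = (if m \<le> x \<and> x < m + k + 1 then C (x - m) else V x)"
  shows "pending ch R' V' (m + k + 1)"
    "open_node ch R V m \<Longrightarrow> open_node ch R' V' (m + k + 1)"
    "\<exists>i\<le>k. extendable (insert (C i) (ch ` {Suc r..d})) \<Longrightarrow> open_node ch R' V' (m + k + 1)"
proof -
  have old: "R' x = R x" "V' x = V x" if "x < m" for x using that assms(5,6) by simp_all
  have new: "R' x = r" "V' x = C (x - m)" if "m \<le> x" "x < m + k + 1" for x using that assms(5,6) by simp_all
  have "branch (ch(R' i := V' i)) (R' i)" if "i < m + k + 1" for i
  proof (cases "i < m")
    case True
    then show ?thesis using old assms(1) by (simp add: pending_def)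
  next
    case False
    then show ?thesis using new[of i] that assms(4)[of "i - m"] branch_child[OF assms(2)] by simp
  qed
  moreover have "R' j \<le> R' i" if "j < m + k + 1" "i < j" for i j
    using assms(1,3,5) that unfolding pending_def
    by (metis Suc_leD le_refl linorder_not_le order.strict_trans)
  ultimately show "pending ch R' V' (m + k + 1)" by (simp add: pending_def)
  show "open_node ch R' V' (m + k + 1)" if on: "open_node ch R V m"
  proof -
    obtain i where "i < m" "extendable (node ch (R i) (V i))" using on by (auto simp: open_node_def)
    then show ?thesis unfolding open_node_def using old by (intro exI[of _ i]) simp
  qed
  show "open_node ch R' V' (m + k + 1)" if ex: "\<exists>i\<le>k. extendable (insert (C i) (ch ` {Suc r..d}))"
  proof -
    obtain i where "i \<le> k" "extendable (insert (C i) (ch ` {Suc r..d}))" using ex by blast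
    then show ?thesis unfolding open_node_def using new[of "m + i"] node_child[OF assms(2)]
      by (intro exI[of _ "m + i"]) simp
  qed
qed

text \<open>The last conjunct is completeness: for a positive instance, success is flagged or some
  stacked node still leads to a solution.\<close>

definition tree_state :: "state \<Rightarrow> bool" where
  "tree_state s \<longleftrightarrow> loaded s \<and> regs s 2 = d \<and> regs s 3 \<le> 1 \<and>
     pending (arrs s 2) (arrs s 5) (arrs s 6) (regs s 4) \<and>
     (regs s 3 = 1 \<longrightarrow> branch (arrs s 2) (regs s 5) \<and> fractured (arrs s 2 ` {regs s 5..d}) \<and>
        (\<forall>x<n. arrs s 3 x = 1 \<longleftrightarrow> x \<in> arrs s 2 ` {regs s 5..d})) \<and>
     (extendable {n} \<longrightarrow> regs s 3 = 1 \<or> open_node (arrs s 2) (arrs s 5) (arrs s 6) (regs s 4))"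

text \<open>Bounds the visits still to come by the complete subtrees below all stacked
  nodes.\<close>

definition tree_todo :: "state \<Rightarrow> nat" where
  "tree_todo s = (\<Sum>i<regs s 4. tree_size (k + 1) (arrs s 5 i))"

text \<open>Replacing a node of budget \<open>Suc r\<close> by \<open>k + 1\<close> nodes of budget
  \<open>r\<close> lowers the total tree size by exactly one; without children the whole subtree is
  saved.\<close>

lemma wp_visit:
  assumes "tree_state s" "0 < regs s 4" "regs s 3 = 0"
  shows "wp visit (\<lambda>t s'. t \<le> 400 * (n + M + 1) \<and> tree_state s' \<and> tree_todo s' < tree_todo s) s"
proof -
  obtain m where m: "regs s 4 = Suc m" using assms(2) gr0_conv_Suc by blast
  define r where "r = arrs s 5 m"
  define ch where "ch = (arrs s 2)(r := arrs s 6 m)"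
  define D where "D = ch ` {r..d}"
  let ?R = "arrs s 5" and ?V = "arrs s 6"
  have ld: "loaded s" "regs s 2 = d" using assms(1) by (auto simp: tree_state_def)
  have "pending (arrs s 2) ?R ?V (Suc m)" using assms(1) m by (simp add: tree_state_def)
  note pop = pending_pop[OF this, folded r_def, folded ch_def, folded D_def]
  have rd: "r \<le> d" using pop(1) by (simp add: branch_def)
  have ex: "extendable D \<or> open_node ch ?R ?V m" if "extendable {n}"
    using assms(1,3) that m pop(4) by (simp add: tree_state_def)
  define s1 where "s1 = s\<lparr>regs := (regs s)(4 := m, 5 := r), arrs := (arrs s)(2 := ch)\<rparr>"
  have todo: "tree_todo s = (\<Sum>i<m. tree_size (k + 1) (?R i)) + tree_size (k + 1) r"
    by (simp add: tree_todo_def m r_def)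
  let ?goal = "\<lambda>t s'. t \<le> 40 * n + 120 \<and> tree_state s' \<and> tree_todo s' < tree_todo s"
  let ?decision = "Cond (Less (Reg 8) (Plus (Plus (Reg 9) (Reg 1)) (Const 1)))
    (Assign 3 (Const 1)) (Cond (Less (Const 0) (Reg 5)) push Skip)"
  have decision: "wp ?decision ?goal s4"
    if fr: "frame {6..11} {3, 4} s1 s4" and vis: "\<forall>x<n. arrs s4 3 x = 1 \<longleftrightarrow> x \<in> D"
      and res: "if regs s4 8 < regs s4 9 + k + 1 then fractured D
        else k < n \<and> (\<forall>i\<le>k. arrs s4 4 (regs s4 9 + i) \<in> {..<n} - D) \<and>
          (\<forall>S. fractured S \<longrightarrow> D \<subseteq> S \<longrightarrow> (\<exists>i\<le>k. arrs s4 4 (regs s4 9 + i) \<in> S))"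
    for s4
  proof -
    have eq: "loaded s4" "regs s4 2 = d" "regs s4 3 = 0" "regs s4 4 = m" "regs s4 5 = r"
      "arrs s4 2 = ch" "arrs s4 5 = ?R" "arrs s4 6 = ?V" "regs s4 (Suc 0) = k"
      using fr ld assms(3) by (auto simp: frame_def s1_def loaded_def)
    have less: "(\<Sum>i<m. tree_size (k + 1) (?R i)) < tree_todo s"
      using todo tree_size_pos by simp
    consider (small) "regs s4 8 < regs s4 9 + k + 1" "fractured D"
      | (leaf) "\<not> regs s4 8 < regs s4 9 + k + 1" "r = 0"
      | (inner) r' where "\<not> regs s4 8 < regs s4 9 + k + 1" "r = Suc r'"
      using res by (cases r) (auto split: if_splits)
    then show ?thesis
    proof cases
      case small
      then show ?thesis using eq pop(1,2) vis less
        by - (rule wp_simple | simp add: tree_state_def tree_todo_def loaded_def flip: D_def)+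
    next
      case leaf
      then have "\<not> extendable D"
        using not_extendable_leaf[of ch "\<lambda>i. arrs s4 4 (regs s4 9 + i)"] pop(1) res
        unfolding D_def by (auto split: if_splits)
      then have "extendable {n} \<longrightarrow> open_node ch ?R ?V m" using ex by blast
      then show ?thesis using leaf eq pop(2) less
        by - (rule wp_simple | simp add: tree_state_def tree_todo_def)+
    next
      case inner
      let ?C = "\<lambda>i. arrs s4 4 (regs s4 9 + i)"
      have kn: "k < n" and C: "\<And>i. i \<le> k \<Longrightarrow> ?C i \<in> {..<n} - ch ` {Suc r'..d}"
        and hit: "\<And>S. fractured S \<Longrightarrow> D \<subseteq> S \<Longrightarrow> \<exists>i\<le>k. ?C i \<in> S"
        using res inner by (auto simp: D_def split: if_splits)
      have D: "D = ch ` {Suc r'..d}" by (simp add: D_def inner(2))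
      have "tree_state s' \<and> tree_todo s' < tree_todo s"
        if fr': "frame {4, 6} {5, 6} s4 s'" and top: "regs s' 4 = m + k + 1"
          and R': "\<forall>x. arrs s' 5 x = (if m \<le> x \<and> x < m + k + 1 then r' else ?R x)"
          and V': "\<forall>x. arrs s' 6 x = (if m \<le> x \<and> x < m + k + 1 then ?C (x - m) else ?V x)" for s'
      proof -
        have eq': "loaded s'" "regs s' 2 = d" "regs s' 3 = 0" "arrs s' 2 = ch"
          using fr' eq by (auto simp: frame_def loaded_def)
        note push = pending_push[OF pop(2) pop(1)[unfolded inner(2)] pop(3)[unfolded inner(2)] C R' V']
        have "extendable {n} \<Longrightarrow> open_node ch (arrs s' 5) (arrs s' 6) (m + k + 1)"
          using ex push(2,3) extendable_child[of D ?C] hit D by blast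
        then have "tree_state s'" using eq' top push(1) by (simp add: tree_state_def)
        moreover have "tree_todo s' = (\<Sum>i<m. tree_size (k + 1) (?R i)) + (k + 1) * tree_size (k + 1) r'"
        proof -
          have "tree_todo s' = (\<Sum>i<m + (k + 1). tree_size (k + 1) (arrs s' 5 i))"
            by (simp add: tree_todo_def top)
          also have "\<dots> = (\<Sum>i<m. tree_size (k + 1) (arrs s' 5 i)) + (k + 1) * tree_size (k + 1) r'"
            by (rule sum_const_tail) (use R' in simp)
          finally show ?thesis using R' by simp
        qed
        ultimately show ?thesis using todo inner(2) by simp
      qed
      then have "wp push (\<lambda>t s'. t \<le> 40 * (k + 2) \<and> tree_state s' \<and> tree_todo s' < tree_todo s) s4"
        using eq inner(2) by (intro wp_mono[OF wp_push]) simp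
      \<comment> \<open>The \<open>k + 1\<close> vertices found are distinct, so
        \<open>k < n\<close> and pushing them is linear in \<open>n\<close>.\<close>
      then have "wp push (\<lambda>t s'. t \<le> 40 * n + 80 \<and> tree_state s' \<and> tree_todo s' < tree_todo s) s4"
        using kn by (elim wp_mono) simp
      then show ?thesis using inner eq
        by - ((rule wp_Cond; simp), (rule wp_Cond; simp), auto elim: wp_mono)
    qed
  qed
  have "wp (Seq clear (Seq mark (Seq search ?decision)))
    (\<lambda>t s'. t \<le> 20 * (n + 1) + (20 * (d + 2) + (100 * (2 * n + M + 1) + (40 * n + 120))) \<and>
       tree_state s' \<and> tree_todo s' < tree_todo s) s1"
  proof (rule wp_Seq_bound)
    have "regs s1 0 = n" using ld by (simp add: s1_def loaded_def)
    then show "wp clear (\<lambda>t s'. t \<le> 20 * (n + 1) \<and> frame {6} {3} s1 s' \<and> (\<forall>x<n. arrs s' 3 x = 0)) s1"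
      using wp_clear[of s1] by simp
  next
    fix s2 assume s2: "frame {6} {3} s1 s2 \<and> (\<forall>x<n. arrs s2 3 x = 0)"
    then have e2: "regs s2 2 = d" "regs s2 5 = r" "arrs s2 2 = ch" "loaded s2"
      using ld by (auto simp: frame_def s1_def loaded_def)
    show "wp (Seq mark (Seq search ?decision)) (\<lambda>t s'.
       t \<le> 20 * (d + 2) + (100 * (2 * n + M + 1) + (40 * n + 120)) \<and>
       tree_state s' \<and> tree_todo s' < tree_todo s) s2"
    proof (rule wp_Seq_bound)
      show "wp mark (\<lambda>t s'. t \<le> 20 * (d + 2) \<and> frame {6} {3} s2 s' \<and>
          (\<forall>x<n. arrs s' 3 x = (if x \<in> D then 1 else 0))) s2"
        by (rule wp_mono[OF wp_mark]) (use e2 rd s2 in \<open>auto simp: D_def\<close>)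
    next
      fix s3 assume s3: "frame {6} {3} s2 s3 \<and> (\<forall>x<n. arrs s3 3 x = (if x \<in> D then 1 else 0))"
      then have l3: "loaded s3" using e2 by (auto simp: frame_def loaded_def)
      have fr3: "frame {6} {3} s1 s3" using s2 s3 frame_trans by blast
      show "wp (Seq search ?decision) (\<lambda>t s'. t \<le> 100 * (2 * n + M + 1) + (40 * n + 120) \<and>
       tree_state s' \<and> tree_todo s' < tree_todo s) s3"
      proof (rule wp_Seq_bound[OF wp_search[OF l3]])
        show "\<forall>x<n. arrs s3 3 x = (if x \<in> D then 1 else 0)" using s3 by blast
      qed (rule decision; use frame_trans[OF fr3] in auto)
    qed
  qed
  \<comment> \<open>With \<open>d \<le> n\<close> the bounds add up to at most
    \<open>280 * (n + M + 1)\<close>; the rest of 400 pays for popping the node.\<close>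
  then show ?thesis unfolding visit_def using d_le
    apply -
    apply (rule wp_Seq, rule wp_Assign, rule wp_Seq, rule wp_Assign, rule wp_Seq, rule wp_Store)
    apply (simp add: m flip: r_def)
    apply (simp add: s1_def flip: ch_def)
    apply (erule wp_mono)
    by simp
qed

text \<open>Only vertices already passed are added, so the old marks stay right for those ahead. Had
  the scan ended with positive budget, all \<open>n + 1\<close> numbers would occupy at most
  \<open>d\<close> cells, against \<open>d \<le> n\<close>.\<close>

lemma wp_pad:
  assumes "regs s 0 = n" "branch (arrs s 2) (regs s 5)" "fractured (arrs s 2 ` {regs s 5..d})"
    "\<forall>x<n. arrs s 3 x = 1 \<longleftrightarrow> x \<in> arrs s 2 ` {regs s 5..d}"
  shows "wp pad (\<lambda>t s'. t \<le> 40 * (n + 1) \<and> frame {5, 6} {2} s s' \<and>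
     branch (arrs s' 2) 0 \<and> fractured (arrs s' 2 ` {0..d})) s"
proof -
  let ?b = "Conj (Less (Reg 6) (Reg 0)) (Less (Const 0) (Reg 5))"
  let ?c = "Seq (Cond (Equal (Cell 3 (Reg 6)) (Const 1)) Skip
          (Seq (Assign 5 (Minus (Reg 5) (Const 1))) (Store 2 (Reg 5) (Reg 6))))
        (Assign 6 (Plus (Reg 6) (Const 1)))"
  let ?D = "\<lambda>s'. arrs s' 2 ` {regs s' 5..d}"
  let ?I = "\<lambda>s'. frame {5, 6} {2} s s' \<and> regs s' 6 \<le> n \<and> branch (arrs s' 2) (regs s' 5) \<and>
     fractured (?D s') \<and> {..<regs s' 6} \<subseteq> ?D s' \<and>
     (\<forall>x<n. regs s' 6 \<le> x \<longrightarrow> (arrs s 3 x = 1 \<longleftrightarrow> x \<in> ?D s'))"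
  let ?\<Phi> = "\<lambda>s'. 30 * (n - regs s' 6)"
  let ?s = "s\<lparr>regs := (regs s)(6 := 0)\<rparr>"
  have "?I ?s" using assms by (simp add: frame_def)
  moreover have "wp ?c (\<lambda>t s''. ?I s'' \<and> t + ?\<Phi> s'' + bcost ?b + 1 \<le> ?\<Phi> s') s'"
    if I: "?I s'" and b: "bval ?b s'" for s'
  proof -
    have fr: "regs s' 0 = n" "arrs s' 3 = arrs s 3" using I assms(1) by (auto simp: frame_def)
    have lt: "regs s' 6 < n" using b fr by simp
    obtain r where r: "regs s' 5 = Suc r" using b gr0_conv_Suc by auto
    show ?thesis
    proof (cases "arrs s 3 (regs s' 6) = 1")
      case True
      then have "regs s' 6 \<in> ?D s'" using I lt by blast
      then have "{..<Suc (regs s' 6)} \<subseteq> ?D s'" using I by (simp add: lessThan_Suc)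
      then show ?thesis using True I fr lt
        by - (rule wp_simple | simp add: frame_def)+
    next
      case False
      let ?v = "regs s' 6" and ?ch = "arrs s' 2"
      have nin: "?v \<notin> ?ch ` {Suc r..d}" using I lt False r by auto
      have br: "branch ?ch (Suc r)" using I r by simp
      have D': "(?ch(r := ?v)) ` {r..d} = insert ?v (?ch ` {Suc r..d})"
        using node_child[OF br] by (simp add: node_def)
      have f: "branch (?ch(r := ?v)) r" "fractured (insert ?v (?ch ` {Suc r..d}))"
        "{..<Suc ?v} \<subseteq> insert ?v (?ch ` {Suc r..d})"
        "\<forall>x<n. Suc ?v \<le> x \<longrightarrow> (arrs s 3 x = 1 \<longleftrightarrow> x \<in> insert ?v (?ch ` {Suc r..d}))"
        using branch_child[OF br lt nin] I r fractured_mono[of "?ch ` {Suc r..d}"]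
        by (auto simp: lessThan_Suc)
      show ?thesis using False fr lt r f I
        by - (rule wp_simple | simp add: frame_def D' cong del: image_cong_simp)+
    qed
  qed
  ultimately have loop: "wp (While ?b ?c)
     (\<lambda>t s'. ?I s' \<and> \<not> bval ?b s' \<and> t + ?\<Phi> s' \<le> ?\<Phi> ?s + bcost ?b + 1) ?s"
    by (rule wp_While)
  have fin: "regs s' 5 = 0" if I: "?I s'" and b: "\<not> bval ?b s'" for s'
  proof (rule ccontr)
    assume pos: "regs s' 5 \<noteq> 0"
    have "regs s' 0 = n" using I assms(1) by (simp add: frame_def)
    then have "regs s' 6 = n" using I b pos by simp
    moreover have br: "branch (arrs s' 2) (regs s' 5)" using I by simp
    moreover have "n \<in> ?D s'" using br unfolding branch_def by force
    ultimately have "{..n} \<subseteq> ?D s'" using I by (simp add: lessThan_Suc_atMost[symmetric] lessThan_Suc)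
    then have "card {..n} \<le> card (?D s')" by (intro card_mono) auto
    also have "\<dots> = Suc d - regs s' 5" using br by (simp add: branch_def card_image)
    finally show False using pos d_le by simp
  qed
  show ?thesis unfolding pad_def
    apply (rule wp_Seq wp_Assign)+
    apply (simp del: One_nat_def)
    apply (rule wp_mono[OF loop])
    apply (frule fin[OF conjunct1])
    by (auto simp: frame_def)
qed

text \<open>The completed branch is its own witness, so a positive answer is never wrong.\<close>

lemma branch_extendable: "branch ch 0 \<Longrightarrow> fractured (ch ` {0..d}) \<Longrightarrow> extendable {n}"
  unfolding extendable_def branch_def
  by (intro exI[of _ "ch ` {0..d}"]) (auto simp: card_image image_iff)

lemma wp_decide:
  assumes "loaded s" "regs s 2 = d" "regs s 3 = 0" "0 < k"
  shows "wp decide (\<lambda>t s'. t \<le> 1000 * ((k + 1) ^ d * (n + M + 1)) \<and>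
    (if extendable {n} then regs s' 3 = 1 \<and> branch (arrs s' 2) 0 \<and> fractured (arrs s' 2 ` {0..d})
     else regs s' 3 = 0)) s"
proof -
  define X where "X = n + M + 1"
  define Y where "Y = (k + 1) ^ d"
  define Z where "Z = Y * X"
  let ?b = "Conj (Less (Const 0) (Reg 4)) (Equal (Reg 3) (Const 0))"
  let ?res = "\<lambda>s'. if extendable {n}
    then regs s' 3 = 1 \<and> branch (arrs s' 2) 0 \<and> fractured (arrs s' 2 ` {0..d}) else regs s' 3 = 0"
  \<comment> \<open>A visit costs at most \<open>400 * X\<close> and its guard 8, and
    \<open>tree_todo\<close> drops by at least one.\<close>
  let ?\<Phi> = "\<lambda>s. (400 * X + 10) * tree_todo s"
  define s0 where "s0 = s\<lparr>arrs := (arrs s)(5 := (arrs s 5)(0 := d), 6 := (arrs s 6)(0 := n)),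
    regs := (regs s)(4 := 1)\<rparr>"
  have "branch ((arrs s 2)(d := n)) d" by (simp add: branch_def)
  moreover have "node (arrs s 2) d n = {n}" by (simp add: node_def)
  ultimately have init: "tree_state s0"
    using assms(1-3) by (simp add: tree_state_def s0_def loaded_def pending_def open_node_def)
  have step: "wp visit (\<lambda>t s''. tree_state s'' \<and> t + ?\<Phi> s'' + bcost ?b + 1 \<le> ?\<Phi> s') s'"
    if "tree_state s'" "bval ?b s'" for s'
  proof -
    have "wp visit (\<lambda>t s''. t \<le> 400 * X \<and> tree_state s'' \<and> tree_todo s'' < tree_todo s') s'"
      unfolding X_def using that by (intro wp_visit) auto
    then show ?thesis
    proof (rule wp_mono)
      fix t s'' assume *: "t \<le> 400 * X \<and> tree_state s'' \<and> tree_todo s'' < tree_todo s'"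
      then have "(400 * X + 10) * (tree_todo s'' + 1) \<le> ?\<Phi> s'" by (intro mult_le_mono2) simp
      then show "tree_state s'' \<and> t + ?\<Phi> s'' + bcost ?b + 1 \<le> ?\<Phi> s'" using * by simp
    qed
  qed
  \<comment> \<open>Here \<open>k \<ge> 1\<close> enters: the branching number \<open>k + 1\<close>
    is at least 2.\<close>
  have "tree_todo s0 \<le> 2 * Y"
    using tree_size_le[of "k + 1" d] assms(4) by (simp add: tree_todo_def s0_def Y_def)
  then have "?\<Phi> s0 \<le> (400 * X + 10) * (2 * Y)" by (rule mult_le_mono2)
  also have "\<dots> \<le> (410 * X) * (2 * Y)" by (intro mult_le_mono1) (simp add: X_def)
  finally have \<Phi>0: "?\<Phi> s0 \<le> 820 * Z" by (simp add: Z_def mult_ac)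
  have "wp (While ?b visit) (\<lambda>t s'. tree_state s' \<and> \<not> bval ?b s' \<and>
      t + ?\<Phi> s' \<le> ?\<Phi> s0 + bcost ?b + 1) s0"
    by (rule wp_While[where I = tree_state, OF init step])
  then have loop: "wp (While ?b visit) (\<lambda>t s'. t \<le> 820 * Z + 20 \<and>
      tree_state s' \<and> \<not> bval ?b s') s0"
    using \<Phi>0 by (elim wp_mono) simp
  have "1 \<le> Y" by (simp add: Y_def)
  then have XZ: "X \<le> Z" "1 \<le> X" using mult_le_mono1[of 1 Y X] by (simp_all add: X_def Z_def)
  have final: "wp (Cond (Equal (Reg 3) (Const 1)) pad Skip) (\<lambda>t s''. t \<le> 50 * X \<and> ?res s'') s'"
    if ts: "tree_state s'" and nb: "\<not> bval ?b s'" for s'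
  proof (cases "regs s' 3 = 1")
    case True
    then have br: "branch (arrs s' 2) (regs s' 5)" "fractured (arrs s' 2 ` {regs s' 5..d})"
      "\<forall>x<n. arrs s' 3 x = 1 \<longleftrightarrow> x \<in> arrs s' 2 ` {regs s' 5..d}" "regs s' 0 = n"
      using ts by (simp_all add: tree_state_def loaded_def)
    have "wp pad (\<lambda>t s''. t \<le> 40 * X \<and> ?res s'') s'"
    proof (rule wp_mono[OF wp_pad[OF br(4,1,2,3)]])
      fix t s'' assume "t \<le> 40 * (n + 1) \<and> frame {5, 6} {2} s' s'' \<and> branch (arrs s'' 2) 0 \<and>
        fractured (arrs s'' 2 ` {0..d})"
      then show "t \<le> 40 * X \<and> ?res s''"
        using True branch_extendable[of "arrs s'' 2"] by (simp add: X_def frame_def)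
    qed
    then show ?thesis using True XZ
      by (intro wp_Cond) (auto elim!: wp_mono)
  next
    case False
    \<comment> \<open>The loop ended without success, so the stack is empty and completeness refutes
      \<open>extendable {n}\<close>.\<close>
    then have "regs s' 3 = 0" "regs s' 4 = 0" using ts nb by (auto simp: tree_state_def)
    moreover from this have "\<not> extendable {n}" using ts by (auto simp: tree_state_def open_node_def)
    ultimately show ?thesis using XZ by (intro wp_Cond wp_Skip) auto
  qed
  have "wp (Seq (While ?b visit) (Cond (Equal (Reg 3) (Const 1)) pad Skip))
      (\<lambda>t s'. t \<le> (820 * Z + 20) + 50 * X \<and> ?res s') s0"
    by (rule wp_Seq_bound[OF loop]) (use final in blast)
  then have main: "wp (Seq (While ?b visit) (Cond (Equal (Reg 3) (Const 1)) pad Skip))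
      (\<lambda>t s'. t \<le> 900 * Z \<and> ?res s') s0"
    by (rule wp_mono) (use XZ in auto)
  have "\<not> regs s 0 < regs s 2" using assms d_le by (simp add: loaded_def)
  then have "wp decide (\<lambda>t s'. t \<le> 1000 * Z \<and> ?res s') s"
    unfolding decide_def using main assms(1,2) XZ
    apply (intro wp_Cond)
     apply simp
    apply (rule wp_Seq, rule wp_Store, rule wp_Seq, rule wp_Store, rule wp_Seq, rule wp_Assign)
    apply (simp add: loaded_def s0_def)
    apply (erule wp_mono)
    by auto
  then show ?thesis by (simp add: X_def Y_def Z_def)
qed

end

section \<open>Graphs given by adjacency lists\<close>

text \<open>The dummy \<open>n\<close> is not a vertex, so its deletion removes no link.\<close>

lemma (in indexed_graph) fractured_insert: "fractured (insert n D) \<longleftrightarrow> fractured D"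
proof -
  have "link (insert n D) = link D" by (auto simp: link_def)
  then show ?thesis by (auto simp: fractured_def comp_def)
qed

text \<open>Together with \<open>target\<close>, the contents of arrays 0 and 1 of
  \<open>input_state\<close>.\<close>

definition offset :: "nat list list \<Rightarrow> nat \<Rightarrow> nat" where
  "offset al i = (if i \<le> length al then length (concat (take i al)) else 0)"

definition target :: "nat list list \<Rightarrow> nat \<Rightarrow> nat" where
  "target al j = (if j < length (concat al) then concat al ! j else 0)"

lemma offset_Suc: "u < length al \<Longrightarrow> offset al (Suc u) = offset al u + length (al ! u)"
  by (simp add: offset_def take_Suc_conv_app_nth)

lemma target_segment:
  assumes "u < length al"
  shows "target al ` {offset al u..<offset al (Suc u)} = set (al ! u)"
proof -
  let ?p = "concat (take u al)" and ?q = "concat (drop (Suc u) al)"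
  have split: "concat al = ?p @ al ! u @ ?q"
    by (metis assms concat.simps(2) concat_append id_take_nth_drop)
  have tgt: "target al (offset al u + i) = al ! u ! i" if "i < length (al ! u)" for i
    using that assms split by (simp add: target_def offset_def nth_append)
  have "{offset al u..<offset al (Suc u)} = (\<lambda>i. offset al u + i) ` {..<length (al ! u)}"
    unfolding offset_Suc[OF assms] by (auto simp: image_iff intro: le_Suc_ex[THEN exE])
  then have "target al ` {offset al u..<offset al (Suc u)} = (\<lambda>i. al ! u ! i) ` {..<length (al ! u)}"
    using tgt by (auto simp: image_image)
  then show ?thesis by (auto simp: set_conv_nth)
qed

section \<open>Transfer between the graph and its numbering\<close>

locale encoded_graph =
  fixes G :: "'a ugraph" and vs :: "'a list" and al :: "nat list list" and k :: nat
  assumes simple: "simple_graph G" and enc: "adjacency_lists G vs al"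
begin

lemma lists:
  "distinct vs" "set vs = verts G" "length al = length vs"
  "\<And>i. i < length vs \<Longrightarrow> distinct (al ! i)"
  "\<And>i. i < length vs \<Longrightarrow> set (al ! i) = {j. j < length vs \<and> {vs ! i, vs ! j} \<in> edges G}"
  using enc by (auto simp: adjacency_lists_def)

lemma finite_edges: "finite (edges G)"
proof -
  have "edges G \<subseteq> Pow (verts G)" using simple by (auto simp: simple_graph_def)
  then show ?thesis using simple finite_subset by (auto simp: simple_graph_def)
qed

lemma length_concat_sum: "length (concat al) = (\<Sum>i<length vs. length (al ! i))"
  by (simp add: length_concat sum_list_sum_nth lists(3) lessThan_atLeast0)

lemma card_verts: "card (verts G) = length vs"
  using lists distinct_card by metis

text \<open>Every edge is listed at its two ends: map an entry \<open>j\<close> of list \<open>i\<close> to the flag consisting of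
  vertex \<open>i\<close> and the edge.\<close>

lemma length_concat_le: "length (concat al) \<le> 2 * card (edges G)"
proof -
  let ?P = "SIGMA i:{..<length vs}. set (al ! i)"
  let ?F = "SIGMA e:edges G. e"
  let ?f = "\<lambda>(i, j). ({vs ! i, vs ! j}, vs ! i)"
  have fin: "\<forall>e\<in>edges G. finite e \<and> card e = 2"
    using simple finite_subset unfolding simple_graph_def by blast
  have "inj_on ?f ?P"
  proof (rule inj_onI)
    fix p q assume pq: "p \<in> ?P" "q \<in> ?P" "?f p = ?f q"
    obtain i j i' j' where p: "p = (i, j)" "q = (i', j')" by (metis surj_pair)
    have less: "i < length vs" "j < length vs" "i' < length vs" "j' < length vs"
      using pq(1,2) lists(5) by (auto simp: p)
    have eq: "vs ! i = vs ! i'" "{vs ! i, vs ! j} = {vs ! i', vs ! j'}" 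
      using pq(3) unfolding p prod.case prod.inject by blast+
    then have "vs ! j = vs ! j'" by (metis doubleton_eq_iff)
    with less eq(1) show "p = q" using lists(1) by (simp add: p nth_eq_iff_index_eq)
  qed
  moreover have "?f ` ?P \<subseteq> ?F" using lists(5) by auto
  ultimately have "card ?P \<le> card ?F"
    using finite_edges fin by (intro card_inj_on_le[of ?f]) auto
  moreover have "card ?P = (\<Sum>i<length vs. length (al ! i))"
    using lists(4) by (simp add: card_SigmaI distinct_card)
  moreover have "card ?F = 2 * card (edges G)"
    using finite_edges fin by (subst card_SigmaI) (auto simp: mult.commute)
  ultimately show ?thesis using length_concat_sum by simp
qed

sublocale indexed_graph "length vs" k "length (concat al)" "offset al" "target al"
proof
  show "offset al u \<le> offset al (Suc u)" if "u < length vs" for u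
    using that lists(3) by (simp add: offset_Suc)
  have "(\<Sum>u<length vs. offset al (Suc u) - offset al u) = (\<Sum>u<length vs. length (al ! u))"
    using lists(3) by (intro sum.cong) (auto simp: offset_Suc)
  then show "(\<Sum>u<length vs. offset al (Suc u) - offset al u) \<le> length (concat al)"
    by (simp add: length_concat_sum)
  show "target al ` {offset al u..<offset al (Suc u)} \<subseteq> {..<length vs}" if "u < length vs" for u
    using that lists(3,5) by (auto simp: target_segment)
  show "u \<in> target al ` {offset al v..<offset al (Suc v)}"
    if "u < length vs" "v < length vs" "v \<in> target al ` {offset al u..<offset al (Suc u)}" for u v
    using that lists(3,5) by (auto simp: target_segment insert_commute)
qed

lemma N_eq: "u < length vs \<Longrightarrow> N u = {v. v < length vs \<and> {vs ! u, vs ! v} \<in> edges G}"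
  using lists(3,5) by (simp add: N_def target_segment)

lemma adj_delete_iff:
  assumes "i < length vs" "j < length vs" "D \<subseteq> {..<length vs}"
  shows "(vs ! i, vs ! j) \<in> adj (delete_verts G ((!) vs ` D)) \<longleftrightarrow> (i, j) \<in> link D"
proof -
  have "vs ! x \<in> (!) vs ` D \<longleftrightarrow> x \<in> D" if "x < length vs" for x
    using that assms(3) lists(1) nth_eq_iff_index_eq by fastforce
  then show ?thesis using assms by (auto simp: adj_def delete_verts_def link_def N_eq)
qed

text \<open>The numbering carries paths over in both directions; backwards, each new vertex has a
  number because edges stay inside the vertex set.\<close>

lemma component_eq:
  assumes "i < length vs" "i \<notin> D" "D \<subseteq> {..<length vs}"
  shows "{w \<in> verts (delete_verts G ((!) vs ` D)). (vs ! i, w) \<in> (adj (delete_verts G ((!) vs ` D)))\<^sup>*}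
    = (!) vs ` comp D i"
proof -
  let ?H = "delete_verts G ((!) vs ` D)"
  have fwd: "(vs ! i, vs ! j) \<in> (adj ?H)\<^sup>* \<and> j < length vs \<and> j \<notin> D" if "(i, j) \<in> (link D)\<^sup>*" for j
    using that
  proof (induction rule: rtrancl_induct)
    case (step j l)
    then have "l < length vs" "l \<notin> D" by (auto simp: link_def)
    then show ?case using step adj_delete_iff[of j l D] assms(3) by auto
  qed (use assms in simp)
  have bwd: "w \<in> (!) vs ` comp D i" if "(vs ! i, w) \<in> (adj ?H)\<^sup>*" for w
    using that
  proof (induction rule: rtrancl_induct)
    case (step y w)
    then obtain j where j: "y = vs ! j" "(i, j) \<in> (link D)\<^sup>*" by (auto simp: comp_def)
    have "{y, w} \<in> edges G" using step(2) by (auto simp: adj_def delete_verts_def)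
    then have "w \<in> verts G" using simple by (auto simp: simple_graph_def)
    then obtain l where l: "l < length vs" "w = vs ! l" using lists(2) by (metis in_set_conv_nth)
    then have "(j, l) \<in> link D" using step(2) j fwd adj_delete_iff assms(3) by auto
    then show ?case using j(2) l(2) by (auto simp: comp_def)
  qed (auto simp: comp_def)
  have "vs ! j \<in> verts ?H" if "j < length vs" "j \<notin> D" for j
    using that assms(3) lists(1,2) nth_eq_iff_index_eq by (fastforce simp: delete_verts_def)
  then show ?thesis using fwd bwd by (auto simp: comp_def)
qed

lemma components_iff_fractured:
  assumes "D \<subseteq> {..<length vs}"
  shows "(\<forall>C\<in>components (delete_verts G ((!) vs ` D)). card C \<le> k) \<longleftrightarrow> fractured D"
proof -
  let ?H = "delete_verts G ((!) vs ` D)"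
  have inj: "inj_on ((!) vs) {..<length vs}" using lists(1) by (simp add: inj_on_nth)
  have verts: "verts ?H = (!) vs ` ({..<length vs} - D)"
    using assms lists(2) inj by (auto simp: delete_verts_def set_conv_nth inj_on_image_set_diff)
  have "components ?H =
      (\<lambda>v. {w \<in> verts ?H. (v, w) \<in> (adj ?H)\<^sup>*}) ` (!) vs ` ({..<length vs} - D)"
    unfolding components_def verts[symmetric] by blast
  also have "\<dots> = (\<lambda>i. (!) vs ` comp D i) ` ({..<length vs} - D)"
    unfolding image_image by (intro image_cong refl component_eq[OF _ _ assms]) auto
  finally have "components ?H = (\<lambda>i. (!) vs ` comp D i) ` ({..<length vs} - D)" .
  moreover have "card ((!) vs ` comp D i) = card (comp D i)" if "i < length vs" for i
    using comp_subset[OF that] inj by (intro card_image) (rule inj_on_subset)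
  ultimately show ?thesis by (auto simp: fractured_def)
qed

lemma fracture_deletion_set_image:
  assumes "D \<subseteq> {..<length vs}"
  shows "fracture_deletion_set k d G ((!) vs ` D) \<longleftrightarrow> card D = d \<and> fractured D"
proof -
  have "inj_on ((!) vs) D" using lists(1) assms by (auto intro: inj_on_nth)
  moreover have "(!) vs ` D \<subseteq> verts G" using assms by (auto simp: lists(2)[symmetric])
  ultimately show ?thesis
    using components_iff_fractured[OF assms] by (simp add: fracture_deletion_set_def card_image)
qed

lemma fracture_deletion_indices:
  assumes "fracture_deletion k d G"
  obtains D where "D \<subseteq> {..<length vs}" "card D = d" "fractured D"
proof -
  obtain S where S: "fracture_deletion_set k d G S" using assms by (auto simp: fracture_deletion_def)
  then have "S \<subseteq> (!) vs ` {..<length vs}"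
    using lists(2) by (auto simp: fracture_deletion_set_def set_conv_nth)
  then obtain D where "D \<subseteq> {..<length vs}" "S = (!) vs ` D" by (auto simp: subset_image_iff)
  then show ?thesis using S fracture_deletion_set_image that by blast
qed

lemma exec_decide:
  assumes "0 < k" "0 < d"
  shows "\<exists>t s. exec decide (input_state k d al) t s \<and>
        t \<le> 2000 * (max (k + 1) (2 * d - 1) ^ d * graph_size G + 1) \<and>
        answer s = (if fracture_deletion k d G then 1 else 0) \<and>
        (fracture_deletion k d G \<longrightarrow>
           set (output_list d s) \<subseteq> {..<length vs} \<and>
           fracture_deletion_set k d G ((!) vs ` set (output_list d s)))"
proof -
  let ?s = "input_state k d al"
  have regs: "regs ?s 0 = length vs" "regs ?s 1 = k" "regs ?s 2 = d" "regs ?s 3 = 0"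
    by (simp_all add: input_state_def lists(3))
  have arrs: "arrs ?s 0 = offset al" "arrs ?s 1 = target al"
    by (auto simp: input_state_def offset_def target_def)
  show ?thesis
  proof (cases "d \<le> length vs")
    case False
    have "\<not> fracture_deletion k d G"
    proof
      assume "fracture_deletion k d G"
      then obtain D where "D \<subseteq> {..<length vs}" "card D = d" by (rule fracture_deletion_indices)
      then have "d \<le> length vs" using card_mono[of "{..<length vs}" D] by simp
      then show False using False by simp
    qed
    \<comment> \<open>The \<open>+ 1\<close> in the time bound covers this constant cost even for
      the empty graph.\<close>
    moreover have "exec decide ?s (bcost (Less (Reg 0) (Reg 2)) + 1 + 1) ?s"
      unfolding decide_def using False regs by (intro exec_CondTrue exec_Skip) simp
    ultimately show ?thesis using regs 
      by (intro exI[of _ "bcost (Less (Reg 0) (Reg 2)) + 1 + 1"] exI[of _ ?s]) (auto simp: answer_def)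
  next
    case True
    interpret search_tree "length vs" k "length (concat al)" "offset al" "target al" d
      using True by unfold_locales
    have "loaded ?s" using regs arrs by (simp add: loaded_def)
    then obtain t s where ex: "exec decide ?s t s"
      and t: "t \<le> 1000 * ((k + 1) ^ d * (length vs + length (concat al) + 1))"
      and res: "if extendable {length vs}
        then regs s 3 = 1 \<and> branch (arrs s 2) 0 \<and> fractured (arrs s 2 ` {0..d}) else regs s 3 = 0"
      using wp_decide[of ?s] regs assms(1) unfolding wp_def by auto
    let ?m = "max (k + 1) (2 * d - 1)" and ?D = "arrs s 2 ` {..<d}"
    \<comment> \<open>Each edge is listed twice, and the summand 1 is absorbed since
      \<open>0 < d \<le> length vs\<close> gives at least one vertex.\<close>
    have "length vs + length (concat al) + 1 \<le> 2 * graph_size G"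
      using length_concat_le card_verts True assms(2) by (simp add: graph_size_def)
    \<comment> \<open>The search tree needs only the first argument of the maximum as base.\<close>
    then have "(k + 1) ^ d * (length vs + length (concat al) + 1) \<le> ?m ^ d * (2 * graph_size G)"
      by (intro mult_le_mono power_mono) auto
    then have time: "t \<le> 2000 * (?m ^ d * graph_size G + 1)" using t by simp
    have out: "set (output_list d s) = ?D" by (auto simp: output_list_def)
    have sound: "?D \<subseteq> {..<length vs} \<and> fracture_deletion_set k d G ((!) vs ` ?D)" if "extendable {length vs}"
    proof -
      have br: "branch (arrs s 2) 0" "fractured (arrs s 2 ` {0..d})" using res that by auto
      have ins: "arrs s 2 ` {0..d} = insert (length vs) ?D"
        using br(1) by (simp add: branch_def atLeast0AtMost lessThan_Suc_atMost[symmetric] lessThan_Suc)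
      have inj: "inj_on (arrs s 2) {0..d}" and d: "arrs s 2 d = length vs" using br(1) by (auto simp: branch_def)
      \<comment> \<open>Cell \<open>d\<close> holds the dummy and the cells are distinct, so the
        output cells below \<open>d\<close> hold proper vertices.\<close>
      have "x \<noteq> length vs" if "x \<in> ?D" for x
        using that inj_onD[OF inj, of _ d] d by fastforce
      then have sub: "?D \<subseteq> {..<length vs}" using br(1) ins by (fastforce simp: branch_def)
      moreover have "card ?D = d" by (subst card_image[OF inj_on_subset[OF inj]]) auto
      ultimately show ?thesis using fracture_deletion_set_image br(2) ins fractured_insert by simp
    qed
    have "extendable {length vs}" if fd: "fracture_deletion k d G"
    proof -
      obtain D where D: "D \<subseteq> {..<length vs}" "card D = d" "fractured D"
        using fd by (rule fracture_deletion_indices)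
      have "card (insert (length vs) D) \<le> Suc d" using D(2) card_insert_le_m1[of "Suc d" D] by simp
      then show ?thesis unfolding extendable_def using D fractured_insert
        by (intro exI[of _ "insert (length vs) D"]) auto
    qed
    then have iff: "extendable {length vs} \<longleftrightarrow> fracture_deletion k d G"
      using sound by (auto simp: fracture_deletion_def)
    show ?thesis using ex time res sound unfolding iff
      by (intro exI[of _ t] exI[of _ s]) (auto simp: answer_def out)
  qed
qed

end

theorem theoremA3:
  "\<exists>(P::com) (c::nat). \<forall>(k::nat) (d::nat) (G::'a ugraph) (vs::'a list) (al::nat list list).
     k > 0 \<longrightarrow> d > 0 \<longrightarrow> simple_graph G \<longrightarrow> adjacency_lists G vs al \<longrightarrow>
     (\<exists>t s. exec P (input_state k d al) t s \<and>
        t \<le> c * (max (k + 1) (2 * d - 1) ^ d * graph_size G + 1) \<and>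
        answer s = (if fracture_deletion k d G then 1 else 0) \<and>
        (fracture_deletion k d G \<longrightarrow>
           set (output_list d s) \<subseteq> {..<length vs} \<and>
           fracture_deletion_set k d G ((!) vs ` set (output_list d s))))"
proof (rule exI[of _ decide], rule exI[of _ 2000], intro allI impI)
  fix k d :: nat and G :: "'a ugraph" and vs :: "'a list" and al :: "nat list list"
  assume pos: "0 < k" "0 < d" and "simple_graph G" "adjacency_lists G vs al"
  then interpret encoded_graph G vs al k by unfold_locales
  show "\<exists>t s. exec decide (input_state k d al) t s \<and>
        t \<le> 2000 * (max (k + 1) (2 * d - 1) ^ d * graph_size G + 1) \<and>
        answer s = (if fracture_deletion k d G then 1 else 0) \<and>
        (fracture_deletion k d G \<longrightarrow>
           set (output_list d s) \<subseteq> {..<length vs} \<and>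
           fracture_deletion_set k d G ((!) vs ` set (output_list d s)))"
    using pos by (rule exec_decide)
qed

end
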